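(* Let $m,n\in\mathbb N$ with $m\equiv n\pmod 2$, let $\sigma\in\mathcal B_{nm}$, and write $r=\operatorname{rank}(\sigma)$. If $r<n\leq m$, then the sandwich semigroup $\mathcal B_{mn}^\sigma$ is generated by $\Omega=\{\alpha\in\mathcal B_{mn}:\operatorname{rank}(\alpha)>r\}$. Furthermore, every generating set for $\mathcal B_{mn}^\sigma$ contains $\Omega$, and so $$\operatorname{rank}(\mathcal B_{mn}^\sigma)=|\Omega|=\sum_{\substack{r<q\leq n\\ q\equiv n\ (\mathrm{mod}\ 2)}}\binom mq\binom nq(m-q-1)!!\,(n-q-1)!!\,q!.$$
   Context: $\mathbb N=\{0,1,2,\ldots\}$, $[n]=\{1,\ldots,n\}$ (with $[0]=\emptyset$), and $A'=\{a':a\in A\}$, $A''=\{a'':a\in A\}$ for $A\subseteq\mathbb N$. For $m,n\in\mathbb N$, $\mathcal B_{mn}$ is the set of all Brauer partitions, i.e. set partitions of $[m]\cup[n]'$ into blocks of size $2$. For $\alpha\in\mathcal B_{mn}$ and $\beta\in\mathcal B_{nk}$, the product $\alpha\beta\in\mathcal B_{mk}$ is formed as follows: view partitions as graphs whose connected components are the blocks; let $\alpha_\downarrow$ be the graph on $[m]\cup[n]''$ obtained from $\alpha$ by renaming each $x'$ to $x''$, let $\beta^\uparrow$ be the graph on $[n]''\cup[k]'$ obtained from $\beta$ by renaming each $x\in[n]$ to $x''$, and let $\Pi(\alpha,\beta)$ be the union of these graphs on $[m]\cup[n]''\cup[k]'$; two elements of $[m]\cup[k]'$ lie in the same block of $\alpha\beta$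 iff they lie in the same connected component of $\Pi(\alpha,\beta)$. The rank of a partition $\alpha\in\mathcal B_{mn}$ is the number of blocks of $\alpha$ meeting both $[m]$ and $[n]'$. For $\sigma\in\mathcal B_{nm}$, the sandwich semigroup $\mathcal B_{mn}^\sigma$ is the set $\mathcal B_{mn}$ with the associative operation $\alpha\star_\sigma\beta=\alpha\sigma\beta$. The rank of a semigroup $T$, $\operatorname{rank}(T)$, is the minimum size of a generating set for $T$ (as a semigroup). For odd $k\ge 1$, $k!!=k(k-2)\cdots3\cdot1$, and $(-1)!!=1$. *)

theory Defs
  imports "HOL-Library.Disjoint_Sets" "HOL-Number_Theory.Cong"
begin

text \<open>The points \<open>x\<close>, \<open>x'\<close> and \<open>x''\<close> are \<open>Plain x\<close>, \<open>Prime x\<close> and \<open>DPrime x\<close>.\<close>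

datatype point = Plain nat | Prime nat | DPrime nat

definition points :: "nat \<Rightarrow> nat \<Rightarrow> point set" where
  "points m n = Plain ` {1..m} \<union> Prime ` {1..n}"

definition brauer :: "nat \<Rightarrow> nat \<Rightarrow> point set set set" where
  "brauer m n = {\<alpha>. partition_on (points m n) \<alpha> \<and> (\<forall>B\<in>\<alpha>. card B = 2)}"

fun lower_to_middle :: "point \<Rightarrow> point" where
  "lower_to_middle (Prime x) = DPrime x"
| "lower_to_middle (Plain x) = Plain x"
| "lower_to_middle (DPrime x) = DPrime x"

fun upper_to_middle :: "point \<Rightarrow> point" where
  "upper_to_middle (Plain x) = DPrime x"
| "upper_to_middle (Prime x) = Prime x"
| "upper_to_middle (DPrime x) = DPrime x"

text \<open>A partition is viewed as the graph in which two points are adjacent iff they share a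
  block. The adjacency relation below is that of the product graph of \<open>\<alpha>\<close> and \<open>\<beta>\<close>.
  It also relates each covered point to itself, which does not affect the components.\<close>

definition product_graph :: "point set set \<Rightarrow> point set set \<Rightarrow> (point \<times> point) set" where
  "product_graph \<alpha> \<beta> =
     {(x, y). \<exists>B \<in> (`) lower_to_middle ` \<alpha> \<union> (`) upper_to_middle ` \<beta>. x \<in> B \<and> y \<in> B}"

text \<open>For \<open>\<alpha> \<in> brauer m n\<close> and \<open>\<beta> \<in> brauer n k\<close>, \<open>bprod m k \<alpha> \<beta>\<close> is the product
  \<open>\<alpha>\<beta> \<in> brauer m k\<close>. The adjacency relation is symmetric, so its reflexive transitive
  closure is the relation of lying in the same connected component.\<close>

definition bprod :: "nat \<Rightarrow> nat \<Rightarrow> point set set \<Rightarrow> point set set \<Rightarrow> point set set" where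
  "bprod m k \<alpha> \<beta> =
     points m k // {(x, y). x \<in> points m k \<and> y \<in> points m k \<and> (x, y) \<in> (product_graph \<alpha> \<beta>)\<^sup>*}"

definition brank :: "nat \<Rightarrow> nat \<Rightarrow> point set set \<Rightarrow> nat" where
  "brank m n \<alpha> = card {B \<in> \<alpha>. B \<inter> Plain ` {1..m} \<noteq> {} \<and> B \<inter> Prime ` {1..n} \<noteq> {}}"

text \<open>The operation \<open>\<alpha> \<star> \<beta> = (\<alpha>\<sigma>)\<beta>\<close> on \<open>brauer m n\<close>, for \<open>\<sigma> \<in> brauer n m\<close>; here
  \<open>\<alpha>\<sigma> \<in> brauer m m\<close>.\<close>

definition sandwich ::
    "nat \<Rightarrow> nat \<Rightarrow> point set set \<Rightarrow> point set set \<Rightarrow> point set set \<Rightarrow> point set set" where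
  "sandwich m n \<sigma> \<alpha> \<beta> = bprod m n (bprod m m \<alpha> \<sigma>) \<beta>"

text \<open>A semigroup is given by its carrier \<open>S\<close> and its operation \<open>f\<close>.\<close>

inductive_set subsemigroup_gen :: "('a \<Rightarrow> 'a \<Rightarrow> 'a) \<Rightarrow> 'a set \<Rightarrow> 'a set"
  for f :: "'a \<Rightarrow> 'a \<Rightarrow> 'a" and A :: "'a set" where
  base: "a \<in> A \<Longrightarrow> a \<in> subsemigroup_gen f A"
| mult: "a \<in> subsemigroup_gen f A \<Longrightarrow> b \<in> subsemigroup_gen f A \<Longrightarrow> f a b \<in> subsemigroup_gen f A"

definition generates :: "'a set \<Rightarrow> ('a \<Rightarrow> 'a \<Rightarrow> 'a) \<Rightarrow> 'a set \<Rightarrow> bool" where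
  "generates S f A \<longleftrightarrow> A \<subseteq> S \<and> subsemigroup_gen f A = S"

text \<open>Only meaningful for finitely generated semigroups; every \<open>brauer m n\<close> is finite.\<close>

definition semigroup_rank :: "'a set \<Rightarrow> ('a \<Rightarrow> 'a \<Rightarrow> 'a) \<Rightarrow> nat" where
  "semigroup_rank S f = (LEAST k. \<exists>A. generates S f A \<and> finite A \<and> card A = k)"

text \<open>The argument is an integer, so that \<open>(-1)!! = 1\<close> is covered.\<close>

function double_fact :: "int \<Rightarrow> nat" where
  "double_fact k = (if k \<le> 0 then 1 else nat k * double_fact (k - 2))"
  by auto
termination by (relation "measure nat") auto

declare double_fact.simps [simp del]

end

theory Submission
  imports Defs
begin

text \<open>
  A product \<open>\<alpha>\<sigma>\<beta>\<close> has rank at most \<open>r = rank \<sigma>\<close>, since each transversal of a product runs through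
  a transversal of each factor (\<open>brank_bprod_le_left\<close>, \<open>brank_bprod_le_right\<close>). So no element of
  \<open>\<Omega>\<close> is a product in the sandwich semigroup, and every generating set contains \<open>\<Omega>\<close>.

  Conversely, an element \<open>\<gamma>\<close> of rank \<open>q \<le> r\<close> is a product \<open>\<alpha>\<sigma>\<beta>\<close> in which \<open>\<alpha>\<close> and \<open>\<beta>\<close> have rank
  \<open>q + 2\<close> (\<open>sandwich_factorization\<close>). Because \<open>r < n \<le> m\<close>, each of \<open>\<gamma>\<close> and \<open>\<sigma>\<close> has a block of two
  upper points and a block of two lower points, so one upper block of \<open>\<gamma>\<close> can be opened into two
  transversals of \<open>\<alpha>\<close> that an upper block of \<open>\<sigma>\<close> joins again; the lower block and \<open>\<beta>\<close> are treated
  dually. Iterating this, the rank of the factors grows until it exceeds \<open>r\<close>, so \<open>\<Omega>\<close> generates.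

  Both parts need that a product of Brauer partitions is a Brauer partition. A product graph is a
  union of two matchings, so its components are orbits of a pair of involutions, and such an orbit
  contains none or exactly two of the outer points (\<open>involutions_fixed_points\<close>,
  \<open>outer_matching\<close>).

  The cardinality of \<open>\<Omega>\<close> comes from splitting a Brauer partition of rank \<open>q\<close> into its upper blocks,
  its lower blocks and its transversals (\<open>card_matchings_crossing\<close>).
\<close>

section \<open>Perfect matchings of a set\<close>

text \<open>A perfect matching of \<open>S\<close> is represented by its set of edges, a partition of \<open>S\<close> into
  blocks of size two. Brauer partitions are the perfect matchings of \<open>points m n\<close>.\<close>

definition matchings :: "'a set \<Rightarrow> 'a set set set" where
  "matchings S = {P. partition_on S P \<and> (\<forall>B\<in>P. card B = 2)}"

lemma matchings_iff:
  "P \<in> matchings S \<longleftrightarrow>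
    \<Union>P = S \<and> (\<forall>B\<in>P. card B = 2) \<and> (\<forall>B\<in>P. \<forall>C\<in>P. B \<noteq> C \<longrightarrow> B \<inter> C = {})"
  unfolding matchings_def partition_on_def disjoint_def by force

lemma matchings_block_subset: "P \<in> matchings S \<Longrightarrow> B \<in> P \<Longrightarrow> B \<subseteq> S"
  unfolding matchings_iff by blast

lemma matchings_unique_block:
  assumes "P \<in> matchings S" "B \<in> P" "C \<in> P" "x \<in> B" "x \<in> C"
  shows "B = C"
  using assms unfolding matchings_iff by blast

lemma matchings_block:
  assumes "P \<in> matchings S" "B \<in> P" "x \<in> B"
  obtains y where "y \<in> S" "y \<noteq> x" "B = {x, y}" "x \<in> S"
proof -
  have "card B = 2" "B \<subseteq> S" using assms unfolding matchings_iff by blast+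
  then obtain u v where "B = {u, v}" "u \<noteq> v" "{u, v} \<subseteq> S" by (auto simp: card_2_iff)
  with \<open>x \<in> B\<close> that[of u] that[of v] show ?thesis by auto
qed

lemma matchings_cover:
  assumes "P \<in> matchings S" "x \<in> S"
  obtains y where "{x, y} \<in> P" "y \<in> S" "y \<noteq> x"
proof -
  from assms obtain B where "B \<in> P" "x \<in> B" unfolding matchings_iff by blast
  with assms show ?thesis using that by (metis matchings_block)
qed

lemma matchings_subset_eq:
  assumes "P \<in> matchings S" "Q \<in> matchings S" "P \<subseteq> Q"
  shows "P = Q"
proof
  show "Q \<subseteq> P"
  proof
    fix B assume "B \<in> Q"
    then obtain x where "x \<in> B" "x \<in> S"
      using assms(2) unfolding matchings_iff by (metis Union_iff card.empty equals0I zero_neq_numeral)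
    then obtain C where "C \<in> P" "x \<in> C" using assms(1) unfolding matchings_iff by blast
    with \<open>B \<in> Q\<close> \<open>x \<in> B\<close> assms show "B \<in> P" by (metis matchings_unique_block subsetD)
  qed
qed (fact assms(3))

lemma matchings_Un:
  assumes "P \<in> matchings S" "Q \<in> matchings T" "S \<inter> T = {}"
  shows "P \<union> Q \<in> matchings (S \<union> T)"
proof -
  have "B \<inter> C = {}" if "B \<in> P" "C \<in> Q" for B C
    using assms that unfolding matchings_iff by blast
  moreover have "B \<inter> C = {}" if "B \<in> P" "C \<in> P" "B \<noteq> C" for B C
    using assms(1) that unfolding matchings_iff by simp
  moreover have "B \<inter> C = {}" if "B \<in> Q" "C \<in> Q" "B \<noteq> C" for B C
    using assms(2) that unfolding matchings_iff by simp
  moreover have "card B = 2" if "B \<in> P \<union> Q" for B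
    using assms(1,2) that unfolding matchings_iff by blast
  moreover have "\<Union>(P \<union> Q) = S \<union> T" using assms(1,2) unfolding matchings_iff by simp
  moreover have "C \<inter> B = {}" if "B \<in> P" "C \<in> Q" for B C
    using calculation(1)[OF that] by (simp add: Int_commute)
  ultimately show ?thesis unfolding matchings_iff by (intro conjI ballI impI) (assumption | elim UnE; simp)+
qed

lemma matchings_image:
  assumes "P \<in> matchings S" "inj_on f S"
  shows "(`) f ` P \<in> matchings (f ` S)"
proof -
  have sub: "B \<subseteq> S" if "B \<in> P" for B using assms(1) that unfolding matchings_iff by blast
  have "card (f ` B) = card B" if "B \<in> P" for B
    by (rule card_image) (rule inj_on_subset[OF assms(2) sub[OF that]])
  moreover have "f ` B \<inter> f ` C = f ` (B \<inter> C)" if "B \<in> P" "C \<in> P" for B C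
    using inj_on_image_Int[OF assms(2) sub sub] that by simp
  moreover have "B \<inter> C = {}" if "f ` B \<noteq> f ` C" "B \<in> P" "C \<in> P" for B C
    using assms(1) that unfolding matchings_iff by metis
  moreover have "\<Union>P = S" "\<forall>B\<in>P. card B = 2" using assms(1) unfolding matchings_iff by auto
  ultimately show ?thesis unfolding matchings_iff by (auto simp del: image_is_empty)
qed

lemma finite_matchings: "finite S \<Longrightarrow> finite (matchings S)"
  unfolding matchings_def by (rule finite_subset[OF _ finitely_many_partition_on]) auto

lemma finite_matching: "finite S \<Longrightarrow> P \<in> matchings S \<Longrightarrow> finite P"
  unfolding matchings_def using finite_elements by blast

text \<open>The partner of a point in a matching. A point that no block covers is its own partner, so
  that for a matching \<open>P\<close> the map \<open>mate P\<close> is an involution of the whole type whose fixed points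
  are the points outside the matched set.\<close>

definition mate :: "'a set set \<Rightarrow> 'a \<Rightarrow> 'a" where
  "mate P x = (if \<exists>y. y \<noteq> x \<and> {x, y} \<in> P then SOME y. y \<noteq> x \<and> {x, y} \<in> P else x)"

lemma mate_eq:
  assumes "P \<in> matchings S" "{x, y} \<in> P"
  shows "mate P x = y"
proof -
  have "card {x, y} = 2" using assms unfolding matchings_iff by blast
  then have "y \<noteq> x" by auto
  moreover have "z = y" if "z \<noteq> x" "{x, z} \<in> P" for z
    using matchings_unique_block[OF assms(1) that(2) assms(2), of x] that \<open>y \<noteq> x\<close>
    by (auto simp: doubleton_eq_iff)
  ultimately have "(SOME y. y \<noteq> x \<and> {x, y} \<in> P) = y"
    using assms(2) by (intro some_equality conjI) blast+
  moreover have "\<exists>y. y \<noteq> x \<and> {x, y} \<in> P" using assms(2) \<open>y \<noteq> x\<close> by blast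
  ultimately show ?thesis unfolding mate_def by (simp only: if_True)
qed

lemma mate_block:
  assumes "P \<in> matchings S" "B \<in> P" "x \<in> B" "y \<in> B" "x \<noteq> y"
  shows "mate P x = y"
proof -
  from assms(1-3) obtain z where "B = {x, z}" by (rule matchings_block)
  moreover from this have "z = y" using assms by blast
  ultimately show ?thesis using mate_eq[OF assms(1)] assms(2) by blast
qed

lemma mate_outside:
  assumes "P \<in> matchings S" "x \<notin> S"
  shows "mate P x = x"
  using assms unfolding mate_def matchings_iff by auto

lemma mate_inside:
  assumes "P \<in> matchings S" "x \<in> S"
  shows "mate P x \<in> S" "mate P x \<noteq> x" "{x, mate P x} \<in> P"
  using assms by (metis matchings_cover mate_eq)+

lemma mate_mate:
  assumes "P \<in> matchings S"
  shows "mate P (mate P x) = x"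
  using assms mate_inside[OF assms, of x] mate_outside[OF assms, of x] mate_eq[OF assms, of "mate P x" x]
  by (cases "x \<in> S") (auto simp: insert_commute)

lemma mate_fixed_iff:
  assumes "P \<in> matchings S"
  shows "mate P x = x \<longleftrightarrow> x \<notin> S"
  using mate_inside[OF assms, of x] mate_outside[OF assms, of x] by blast

section \<open>Components of a union of two matchings\<close>

text \<open>The orbit of a point \<open>x\<close> under two involutions \<open>f\<close> and \<open>g\<close> of a finite set, where
  \<open>g x = x\<close> and \<open>f\<close>, \<open>g\<close> have no common fixed point, contains exactly two points that \<open>f\<close> or
  \<open>g\<close> fixes. If \<open>h = g \<circ> f\<close> and \<open>x\<close> has period \<open>p\<close> under \<open>h\<close>, then the orbit consists of
  the points \<open>h\<^sup>i x\<close> with \<open>i\<close> modulo \<open>p\<close>, on which \<open>f\<close> acts as \<open>i \<mapsto> -1 - i\<close> and \<open>g\<close> as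
  \<open>i \<mapsto> -i\<close>. So the fixed points are given by \<open>i = 0\<close> and \<open>i = p div 2\<close>, for both parities of
  \<open>p\<close>.\<close>

lemma involutions_fixed_points:
  fixes f g :: "'a \<Rightarrow> 'a"
  assumes "finite V" "x \<in> V" "f ` V \<subseteq> V" "g ` V \<subseteq> V"
    and f: "\<And>z. f (f z) = z" and g: "\<And>z. g (g z) = z"
    and nofix: "\<And>z. z \<in> V \<Longrightarrow> f z \<noteq> z \<or> g z \<noteq> z"
    and x: "g x = x"
  defines "R \<equiv> {(u, v). v = f u \<or> v = g u}"
  shows "\<exists>y. y \<noteq> x \<and> {z. (x, z) \<in> R\<^sup>* \<and> (f z = z \<or> g z = z)} = {x, y}"
proof -
  define h where "h = g \<circ> f"
  have injf: "inj f" and injg: "inj g" using f g by (metis injI)+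
  then have injh: "inj h" unfolding h_def by (simp add: inj_compose)
  have hV: "(h ^^ i) x \<in> V" for i
    by (induction i) (use assms(2,3,4) in \<open>auto simp: h_def\<close>)
  then have "\<not> inj (\<lambda>i. (h ^^ i) x)"
    using \<open>finite V\<close> by (meson finite_subset image_subsetI infinite_UNIV_nat finite_imageD)
  then obtain i j where "i < j" "(h ^^ i) x = (h ^^ j) x"
    unfolding inj_def by (metis nat_neq_iff)
  then have "(h ^^ i) ((h ^^ (j - i)) x) = (h ^^ i) x"
    by (simp flip: funpow_add[THEN fun_cong, unfolded comp_def])
  then have "(h ^^ (j - i)) x = x"
    using inj_fn[OF injh, of i] by (simp add: inj_eq)
  then have ex: "\<exists>p>0. (h ^^ p) x = x" using \<open>i < j\<close> by (metis zero_less_diff)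
  define p where "p = (LEAST p. 0 < p \<and> (h ^^ p) x = x)"
  have p: "0 < p" "(h ^^ p) x = x"
    using LeastI_ex[OF ex] unfolding p_def by auto
  have pmin: "(h ^^ i) x \<noteq> x" if "0 < i" "i < p" for i
    using not_less_Least[of i "\<lambda>p. 0 < p \<and> (h ^^ p) x = x"] that unfolding p_def by auto
  have inj: "i = j" if "(h ^^ i) x = (h ^^ j) x" "i < p" "j < p" for i j
  proof -
    have *: False if "i < j" "(h ^^ i) x = (h ^^ j) x" "j < p" for i j
    proof -
      have "(h ^^ i) ((h ^^ (j - i)) x) = (h ^^ i) x"
        using that by (simp flip: funpow_add[THEN fun_cong, unfolded comp_def])
      then have "(h ^^ (j - i)) x = x"
        using inj_fn[OF injh, of i] by (simp add: inj_eq)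
      with that pmin[of "j - i"] less_imp_diff_less[of j p i] show False by simp
    qed
    from that *[of i j] *[of j i] show ?thesis by (metis nat_neq_iff)
  qed
  have fh: "f ((h ^^ i) x) = (h ^^ (p - 1 - i)) x" if "i < p" for i
    using that
  proof (induction i)
    case 0
    have "h (f x) = x" using f x by (simp add: h_def)
    also have "\<dots> = (h ^^ Suc (p - 1)) x" using p by simp
    also have "\<dots> = h ((h ^^ (p - 1)) x)" by simp
    finally have "h (f x) = h ((h ^^ (p - 1)) x)" .
    then show ?case using injh by (simp add: inj_eq)
  next
    case (Suc i)
    have "h (f ((h ^^ Suc i) x)) = f ((h ^^ i) x)" using f g by (simp add: h_def)
    also have "\<dots> = (h ^^ (Suc (p - 1 - Suc i))) x" using Suc by (simp add: Suc_diff_Suc)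
    also have "\<dots> = h ((h ^^ (p - 1 - Suc i)) x)" by simp
    finally show ?case using injh by (simp add: inj_eq)
  qed
  have gh: "g ((h ^^ i) x) = (h ^^ (p - i)) x" if "i < p" for i
  proof -
    have "g ((h ^^ i) x) = h (f ((h ^^ i) x))" using f by (simp add: h_def)
    also have "\<dots> = (h ^^ Suc (p - 1 - i)) x" using fh[OF that] by simp
    also have "Suc (p - 1 - i) = p - i" using that by simp
    finally show ?thesis .
  qed
  define C where "C = (\<lambda>i. (h ^^ i) x) ` {..<p}"
  have "f u \<in> C" if "u \<in> C" for u
    using that fh p(1) unfolding C_def by (auto intro!: image_eqI)
  moreover have "g u \<in> C" if "u \<in> C" for u
  proof -
    from that obtain i where i: "i < p" "u = (h ^^ i) x" unfolding C_def by auto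
    show ?thesis
    proof (cases "i = 0")
      case True then show ?thesis using that x i by simp
    next
      case False then show ?thesis using i gh[of i] p(1) unfolding C_def by auto
    qed
  qed
  ultimately have step: "v \<in> C" if "(u, v) \<in> R" "u \<in> C" for u v using that unfolding R_def by auto
  have "v \<in> C" if "(x, v) \<in> R\<^sup>*" for v
    using that
  proof induction
    case base
    show ?case using p(1) unfolding C_def by (auto intro: image_eqI[of _ _ 0])
  qed (rule step)
  moreover have "(x, (h ^^ i) x) \<in> R\<^sup>*" for i
  proof (induction i)
    case (Suc i)
    have "((h ^^ i) x, f ((h ^^ i) x)) \<in> R" "(f ((h ^^ i) x), g (f ((h ^^ i) x))) \<in> R"
      by (auto simp: R_def)
    with Suc have "(x, g (f ((h ^^ i) x))) \<in> R\<^sup>*" by (meson rtrancl.rtrancl_into_rtrancl)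
    moreover have "(h ^^ Suc i) x = g (f ((h ^^ i) x))" unfolding h_def by simp
    ultimately show ?case by simp
  qed simp
  ultimately have comp: "(x, v) \<in> R\<^sup>* \<longleftrightarrow> v \<in> C" for v unfolding C_def by auto
  have "1 < p"
  proof (rule ccontr)
    assume "\<not> 1 < p"
    then have "p = 1" using p(1) by simp
    then have "f x = x" using fh[of 0] by simp
    with nofix[of x] x assms(2) show False by auto
  qed
  have fixed: "f ((h ^^ i) x) = (h ^^ i) x \<or> g ((h ^^ i) x) = (h ^^ i) x \<longleftrightarrow> i = 0 \<or> i = p div 2"
    if "i < p" for i
  proof -
    have 1: "f ((h ^^ i) x) = (h ^^ i) x \<longleftrightarrow> p - 1 - i = i"
      using inj[of "p - 1 - i" i] fh[OF that] that by auto
    have 2: "g ((h ^^ i) x) = (h ^^ i) x \<longleftrightarrow> i = 0 \<or> p - i = i"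
    proof (cases "i = 0")
      case True then show ?thesis using x by simp
    next
      case False then show ?thesis using inj[of "p - i" i] gh[OF that] that by auto
    qed
    have 3: "p - 1 - i = i \<longleftrightarrow> p = 2 * i + 1" "p - i = i \<longleftrightarrow> p = 2 * i" using that by auto
    have 4: "i = p div 2 \<longleftrightarrow> p = 2 * i \<or> p = 2 * i + 1"
    proof
      assume "i = p div 2"
      then show "p = 2 * i \<or> p = 2 * i + 1" by linarith
    qed auto
    show ?thesis unfolding 1 2 3 4 by blast
  qed
  have "{z. (x, z) \<in> R\<^sup>* \<and> (f z = z \<or> g z = z)} = {x, (h ^^ (p div 2)) x}"
  proof (intro set_eqI)
    fix z
    have "z \<in> C \<and> (f z = z \<or> g z = z) \<longleftrightarrow> (\<exists>i<p. z = (h ^^ i) x \<and> (i = 0 \<or> i = p div 2))"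
      using fixed unfolding C_def by auto
    also have "\<dots> \<longleftrightarrow> z \<in> {x, (h ^^ (p div 2)) x}"
      using p(1) \<open>1 < p\<close> by (auto intro: exI[of _ 0] exI[of _ "p div 2"])
    finally show "z \<in> {z. (x, z) \<in> R\<^sup>* \<and> (f z = z \<or> g z = z)} \<longleftrightarrow> z \<in> {x, (h ^^ (p div 2)) x}"
      by (simp add: comp)
  qed
  moreover have "(h ^^ (p div 2)) x \<noteq> x" using pmin[of "p div 2"] \<open>1 < p\<close> by simp
  ultimately show ?thesis by blast
qed

text \<open>The graph of a set of blocks: two points are adjacent iff they share a block.\<close>

definition block_rel :: "'a set set \<Rightarrow> ('a \<times> 'a) set" where
  "block_rel P = {(x, y). \<exists>B\<in>P. x \<in> B \<and> y \<in> B}"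

lemma sym_block_rel: "sym ((block_rel P)\<^sup>*)"
  by (rule sym_rtrancl) (auto simp: block_rel_def sym_def)

text \<open>The partition of \<open>S\<close> induced by the connected components of the graph of \<open>P\<close>. Points
  outside \<open>S\<close> only serve to connect. The product of Brauer partitions is of this form, with \<open>S\<close>
  the set of upper and lower points.\<close>

definition outer_components :: "'a set \<Rightarrow> 'a set set \<Rightarrow> 'a set set" where
  "outer_components S P = S // {(x, y). x \<in> S \<and> y \<in> S \<and> (x, y) \<in> (block_rel P)\<^sup>*}"

lemma equiv_outer_components: "equiv S {(x, y). x \<in> S \<and> y \<in> S \<and> (x, y) \<in> (block_rel P)\<^sup>*}"
proof (rule equivI)
  show "sym {(x, y). x \<in> S \<and> y \<in> S \<and> (x, y) \<in> (block_rel P)\<^sup>*}"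
    using sym_block_rel[of P] by (auto simp: sym_def)
  show "trans {(x, y). x \<in> S \<and> y \<in> S \<and> (x, y) \<in> (block_rel P)\<^sup>*}"
    by (auto intro!: transI)
qed (auto simp: refl_on_def)

text \<open>A component of the union of a matching on \<open>A \<union> M\<close> and one on \<open>M \<union> B\<close> that is not
  contained in \<open>M\<close> meets \<open>A \<union> B\<close> in exactly two points: among all the points
  concerned, those of \<open>A\<close> are fixed by the partner involution of \<open>Q\<close>, and those of \<open>B\<close> by the one
  of \<open>P\<close>.\<close>

lemma outer_matching:
  assumes P: "P \<in> matchings (A \<union> M)" and Q: "Q \<in> matchings (M \<union> B)"
    and disj: "A \<inter> M = {}" "M \<inter> B = {}" "A \<inter> B = {}" and fin: "finite A" "finite M" "finite B"
  shows "outer_components (A \<union> B) (P \<union> Q) \<in> matchings (A \<union> B)"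
proof -
  define E where "E = (block_rel (P \<union> Q))\<^sup>*"
  define f where "f = mate P"
  define g where "g = mate Q"
  define R where "R = {(u, v). v = f u \<or> v = g u}"
  have "(u, v) \<in> E" if "v = f u" for u v
  proof (cases "u \<in> A \<union> M")
    case True
    have "(u, v) \<in> block_rel (P \<union> Q)"
      using mate_inside(3)[OF P True] that unfolding f_def block_rel_def by auto
    then show ?thesis unfolding E_def ..
  next
    case False
    then show ?thesis using that mate_outside[OF P] unfolding f_def E_def by simp
  qed
  moreover have "(u, v) \<in> E" if "v = g u" for u v
  proof (cases "u \<in> M \<union> B")
    case True
    have "(u, v) \<in> block_rel (P \<union> Q)"
      using mate_inside(3)[OF Q True] that unfolding g_def block_rel_def by auto
    then show ?thesis unfolding E_def ..
  next
    case False
    then show ?thesis using that mate_outside[OF Q] unfolding g_def E_def by simp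
  qed
  ultimately have "R \<subseteq> E" unfolding R_def by auto
  then have "R\<^sup>* \<subseteq> E" unfolding E_def by (rule rtrancl_subset_rtrancl)
  moreover have "E \<subseteq> R\<^sup>*"
  proof -
    have "(u, v) \<in> R\<^sup>*" if uv: "(u, v) \<in> block_rel (P \<union> Q)" for u v
    proof (cases "u = v")
      case False
      from uv obtain C where C: "C \<in> P \<or> C \<in> Q" "u \<in> C" "v \<in> C" unfolding block_rel_def by auto
      from C(1) have "v = f u \<or> v = g u"
      proof
        assume "C \<in> P"
        from mate_block[OF P this C(2,3) False] show ?thesis unfolding f_def by simp
      next
        assume "C \<in> Q"
        from mate_block[OF Q this C(2,3) False] show ?thesis unfolding g_def by simp
      qed
      then show ?thesis unfolding R_def by auto
    qed simp
    then have "block_rel (P \<union> Q) \<subseteq> R\<^sup>*" by auto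
    then show ?thesis unfolding E_def by (rule rtrancl_subset_rtrancl)
  qed
  ultimately have ER: "E = R\<^sup>*" by (rule subset_antisym[rotated])
  have ff: "f (f z) = z" and gg: "g (g z) = z" for z
    unfolding f_def g_def using P Q by (auto simp: mate_mate)
  define V where "V = A \<union> M \<union> B"
  have Vfin: "finite V" using fin unfolding V_def by simp
  have fV: "f ` V \<subseteq> V" 
  proof (rule image_subsetI)
    fix z assume "z \<in> V"
    then show "f z \<in> V" using mate_inside(1)[OF P, of z] mate_outside[OF P, of z]
      unfolding f_def V_def by (cases "z \<in> A \<union> M") auto
  qed
  have gV: "g ` V \<subseteq> V" 
  proof (rule image_subsetI)
    fix z assume "z \<in> V"
    then show "g z \<in> V" using mate_inside(1)[OF Q, of z] mate_outside[OF Q, of z]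
      unfolding g_def V_def by (cases "z \<in> M \<union> B") auto
  qed
  have ffix: "f z = z \<longleftrightarrow> z \<notin> A \<union> M" and gfix: "g z = z \<longleftrightarrow> z \<notin> M \<union> B" for z
    unfolding f_def g_def using P Q by (auto simp: mate_fixed_iff)
  have inV: "z \<in> V" if "(x, z) \<in> E" "x \<in> V" for x z
    using that(1) unfolding ER
    by (induction) (use that(2) fV gV in \<open>auto simp: R_def\<close>)
  have key: "\<exists>y. y \<noteq> x \<and> {z \<in> A \<union> B. (x, z) \<in> E} = {x, y}" if x: "x \<in> A \<union> B" for x
  proof -
    have xV: "x \<in> V" using x unfolding V_def by auto
    have "{z \<in> A \<union> B. (x, z) \<in> E} = {z. (x, z) \<in> E \<and> (f z = z \<or> g z = z)}"
      using inV[OF _ xV] disj unfolding ffix gfix V_def by blast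
    moreover have "\<exists>y. y \<noteq> x \<and> {z. (x, z) \<in> E \<and> (f z = z \<or> g z = z)} = {x, y}"
    proof (cases "x \<in> A")
      case True
      have "g x = x" using True disj unfolding gfix by auto
      from involutions_fixed_points[OF Vfin xV fV gV ff gg _ this]
      show ?thesis unfolding ER R_def using ffix gfix disj unfolding V_def by blast
    next
      case False
      have "f x = x" using x False disj unfolding ffix by auto
      from involutions_fixed_points[OF Vfin xV gV fV gg ff _ this]
      show ?thesis unfolding ER R_def using ffix gfix disj unfolding V_def
        by (auto simp: disj_commute)
    qed
    ultimately show ?thesis by simp
  qed
  let ?r = "{(x, y). x \<in> A \<union> B \<and> y \<in> A \<union> B \<and> (x, y) \<in> (block_rel (P \<union> Q))\<^sup>*}"
  have "partition_on (A \<union> B) (outer_components (A \<union> B) (P \<union> Q))"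
    unfolding outer_components_def by (rule partition_on_quotient[OF equiv_outer_components])
  moreover have "card C = 2" if "C \<in> outer_components (A \<union> B) (P \<union> Q)" for C
  proof -
    from that obtain x where "x \<in> A \<union> B" "C = ?r `` {x}"
      unfolding outer_components_def by (rule quotientE)
    moreover from this have "C = {z \<in> A \<union> B. (x, z) \<in> E}" unfolding E_def by auto
    ultimately show ?thesis using key[of x] by auto
  qed
  ultimately show ?thesis unfolding matchings_def by blast
qed

text \<open>The blocks of \<open>P\<close> that meet both \<open>X\<close> and \<open>Y\<close>. For a Brauer partition and its upper and lower
  points these are the transversals, and their number is the rank.\<close>

definition crossing :: "'a set \<Rightarrow> 'a set \<Rightarrow> 'a set set \<Rightarrow> 'a set set" where
  "crossing X Y P = {B \<in> P. B \<inter> X \<noteq> {} \<and> B \<inter> Y \<noteq> {}}"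

lemma crossing_commute: "crossing X Y P = crossing Y X P"
  unfolding crossing_def by auto

text \<open>A component that joins \<open>A\<close> to \<open>B\<close> has to leave \<open>A\<close>, and it can do so only through a block of
  \<open>P\<close> between \<open>A\<close> and \<open>M\<close>. Distinct components use distinct blocks.\<close>

lemma card_crossing_outer_le:
  assumes P: "P \<in> matchings (A \<union> M)" and Q: "Q \<in> matchings (M \<union> B)"
    and disj: "A \<inter> M = {}" "M \<inter> B = {}" "A \<inter> B = {}" and fin: "finite A" "finite M"
  shows "card (crossing A B (outer_components (A \<union> B) (P \<union> Q))) \<le> card (crossing A M P)"
proof -
  define E where "E = (block_rel (P \<union> Q))\<^sup>*"
  define r where "r = {(x, y). x \<in> A \<union> B \<and> y \<in> A \<union> B \<and> (x, y) \<in> (block_rel (P \<union> Q))\<^sup>*}"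
  have equiv: "equiv (A \<union> B) r" unfolding r_def by (rule equiv_outer_components)
  have outer_components: "outer_components (A \<union> B) (P \<union> Q) = (A \<union> B) // r" unfolding outer_components_def r_def ..
  show ?thesis
  proof (rule card_le_if_inj_on_rel[where r = "\<lambda>W K. \<exists>x\<in>W. \<exists>z\<in>K. (x, z) \<in> E"])
    show "finite (crossing A M P)"
      using finite_matching[OF _ P] fin unfolding crossing_def by auto
  next
    fix W assume "W \<in> crossing A B (outer_components (A \<union> B) (P \<union> Q))"
    then obtain x y where W: "W \<in> (A \<union> B) // r" and xy: "x \<in> W" "x \<in> A" "y \<in> W" "y \<in> B"
      unfolding crossing_def outer_components by auto
    then have "(x, y) \<in> r" using quotient_eq_iff[OF equiv W W] by blast
    then have xyE: "(x, y) \<in> E" unfolding r_def E_def by auto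
    show "\<exists>K. K \<in> crossing A M P \<and> (\<exists>x\<in>W. \<exists>z\<in>K. (x, z) \<in> E)"
    proof (rule ccontr)
      assume neg: "\<not> ?thesis"
      have "z \<in> A" if "(x, z) \<in> E" for z
        using that unfolding E_def
      proof induction
        case (step u v)
        then obtain K where K: "K \<in> P \<or> K \<in> Q" "u \<in> K" "v \<in> K" unfolding block_rel_def by auto
        moreover have "K \<notin> Q" using matchings_block_subset[OF Q, of K] K(2) step.IH disj by blast
        ultimately have "K \<in> P" by blast
        moreover have "K \<notin> crossing A M P"
          using neg xy(1) K(2) step.hyps(1) unfolding E_def by blast
        moreover have "K \<subseteq> A \<union> M" using \<open>K \<in> P\<close> matchings_block_subset[OF P] by blast
        ultimately show ?case using step.IH K unfolding crossing_def by blast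
      qed (fact xy(2))
      with xyE xy(4) disj show False by blast
    qed
  next
    fix W1 W2 K
    assume W: "W1 \<in> crossing A B (outer_components (A \<union> B) (P \<union> Q))" "W2 \<in> crossing A B (outer_components (A \<union> B) (P \<union> Q))"
      and K: "K \<in> crossing A M P"
      and r1: "\<exists>x\<in>W1. \<exists>z\<in>K. (x, z) \<in> E" and r2: "\<exists>x\<in>W2. \<exists>z\<in>K. (x, z) \<in> E"
    from r1 r2 obtain x1 z1 x2 z2 where xz: "x1 \<in> W1" "z1 \<in> K" "(x1, z1) \<in> E"
      "x2 \<in> W2" "z2 \<in> K" "(x2, z2) \<in> E" by blast
    have "(z1, z2) \<in> E" using xz K unfolding E_def crossing_def block_rel_def by blast
    moreover have "(z2, x2) \<in> E" using xz(6) sym_block_rel unfolding E_def by (metis symD)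
    ultimately have "(x1, x2) \<in> E" using xz(3) unfolding E_def by (meson rtrancl_trans)
    moreover have W': "W1 \<in> (A \<union> B) // r" "W2 \<in> (A \<union> B) // r"
      using W unfolding crossing_def outer_components by auto
    moreover have "x1 \<in> A \<union> B" "x2 \<in> A \<union> B"
      using W' xz in_quotient_imp_subset[OF equiv] by blast+
    ultimately have "(x1, x2) \<in> r" unfolding r_def E_def by auto
    then show "W1 = W2" using quotient_eq_iff[OF equiv W' xz(1,4)] by blast
  qed
qed

section \<open>Counting matchings\<close>

lemma card_matching:
  assumes "finite S" "P \<in> matchings S"
  shows "card S = 2 * card P"
  using card_partition[of P 2] finite_matching[OF assms] assms unfolding matchings_iff by auto

lemma matchings_remove:
  assumes "P \<in> matchings S" "{a, b} \<in> P"
  shows "P - {{a, b}} \<in> matchings (S - {a, b})"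
proof -
  have "B \<inter> {a, b} = {}" if "B \<in> P" "B \<noteq> {a, b}" for B
    using assms that unfolding matchings_iff by metis
  then have "\<Union>(P - {{a, b}}) = \<Union>P - {a, b}" using assms(2) by blast
  also have "\<Union>P = S" using assms(1) unfolding matchings_iff by simp
  finally have "\<Union>(P - {{a, b}}) = S - {a, b}" .
  then show ?thesis using assms(1) unfolding matchings_iff by auto
qed

lemma matchings_doubleton: "a \<noteq> b \<Longrightarrow> {{a, b}} \<in> matchings {a, b}"
  unfolding matchings_iff by auto

lemma matchings_insert:
  assumes "P \<in> matchings S" "a \<noteq> b" "a \<notin> S" "b \<notin> S"
  shows "insert {a, b} P \<in> matchings ({a, b} \<union> S)"
  using matchings_Un[OF matchings_doubleton[OF assms(2)] assms(1)] assms by auto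

text \<open>Matchings with a prescribed kind of block are counted by the partner \<open>b\<close> of a chosen point
  \<open>a\<close>. The condition \<open>E\<close> covers both all matchings and those between two disjoint sets.\<close>

lemma card_restricted_matchings_insert:
  fixes E :: "'a set \<Rightarrow> bool"
  defines "M S \<equiv> {P \<in> matchings S. \<forall>B\<in>P. E B}"
  assumes "finite S" "a \<notin> S"
  shows "card (M (insert a S)) = (\<Sum>b \<in> {b \<in> S. E {a, b}}. card (M (S - {b})))"
proof -
  have notin: "a \<notin> B" if "P \<in> M (S - {b})" "B \<in> P" for P B b
    using that matchings_block_subset[of P _ B] assms(3) unfolding M_def by blast
  have "M (insert a S) = (\<Union>b \<in> {b \<in> S. E {a, b}}. insert {a, b} ` M (S - {b}))"
  proof (intro equalityI subsetI)
    fix P assume P: "P \<in> M (insert a S)"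
    then have Pm: "P \<in> matchings (insert a S)" unfolding M_def by simp
    then obtain b where b: "{a, b} \<in> P" "b \<in> insert a S" "b \<noteq> a"
      by (rule matchings_cover) auto
    have "P - {{a, b}} \<in> matchings (insert a S - {a, b})" by (rule matchings_remove[OF Pm b(1)])
    moreover have "insert a S - {a, b} = S - {b}" using assms(3) by auto
    ultimately have "P - {{a, b}} \<in> M (S - {b})" using P unfolding M_def by auto
    moreover have "P = insert {a, b} (P - {{a, b}})" using b by auto
    moreover have "E {a, b}" "b \<in> S" using P b unfolding M_def by auto
    ultimately show "P \<in> (\<Union>b \<in> {b \<in> S. E {a, b}}. insert {a, b} ` M (S - {b}))" by blast
  next
    fix P assume "P \<in> (\<Union>b \<in> {b \<in> S. E {a, b}}. insert {a, b} ` M (S - {b}))"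
    then obtain b Q where b: "b \<in> S" "E {a, b}" and Q: "Q \<in> M (S - {b})" "P = insert {a, b} Q"
      by blast
    have "P \<in> matchings ({a, b} \<union> (S - {b}))"
      unfolding Q(2) by (rule matchings_insert) (use Q(1) b assms(3) in \<open>auto simp: M_def\<close>)
    moreover have "{a, b} \<union> (S - {b}) = insert a S" using b by auto
    ultimately show "P \<in> M (insert a S)" using Q b unfolding M_def by auto
  qed
  moreover have "card (\<Union>b \<in> {b \<in> S. E {a, b}}. insert {a, b} ` M (S - {b}))
      = (\<Sum>b \<in> {b \<in> S. E {a, b}}. card (insert {a, b} ` M (S - {b})))"
  proof (rule card_UN_disjoint)
    show "\<forall>i\<in>{b \<in> S. E {a, b}}. finite (insert {a, i} ` M (S - {i}))"
      using finite_matchings[of "S - {i}" for i] assms(2) unfolding M_def by simp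
    show "\<forall>i\<in>{b \<in> S. E {a, b}}. \<forall>j\<in>{b \<in> S. E {a, b}}. i \<noteq> j \<longrightarrow>
        insert {a, i} ` M (S - {i}) \<inter> insert {a, j} ` M (S - {j}) = {}"
    proof (intro ballI impI equals0I)
      fix i j P assume "i \<noteq> j" and P: "P \<in> insert {a, i} ` M (S - {i}) \<inter> insert {a, j} ` M (S - {j})"
      from P obtain Q where Q: "Q \<in> M (S - {j})" "P = insert {a, j} Q" by blast
      from P have "{a, i} \<in> P" by blast
      with notin[OF Q(1)] Q(2) have "{a, i} = {a, j}" by blast
      with \<open>i \<noteq> j\<close> show False by (auto simp: doubleton_eq_iff)
    qed
  qed (use assms in auto)
  moreover have "card (insert {a, b} ` M (S - {b})) = card (M (S - {b}))" for b
  proof (rule card_image)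
    show "inj_on (insert {a, b}) (M (S - {b}))"
    proof (rule inj_onI)
      fix P Q assume "P \<in> M (S - {b})" "Q \<in> M (S - {b})" "insert {a, b} P = insert {a, b} Q"
      moreover have "{a, b} \<notin> P" "{a, b} \<notin> Q" using notin calculation(1,2) by blast+
      ultimately show "P = Q" by (metis insert_ident)
    qed
  qed
  ultimately show ?thesis by simp
qed

lemma matchings_empty: "matchings {} = {{}}"
proof -
  have "P = {}" if "P \<in> matchings {}" for P :: "'a set set"
    using that unfolding matchings_def by (simp add: partition_on_empty)
  moreover have "{} \<in> matchings {}" unfolding matchings_iff by simp
  ultimately show ?thesis by blast
qed

lemma card_matchings:
  assumes "finite S" "even (card S)"
  shows "card (matchings S) = double_fact (int (card S) - 1)"
  using assms
proof (induction "card S" arbitrary: S rule: less_induct)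
  case less
  show ?case
  proof (cases "S = {}")
    case True
    then show ?thesis by (simp add: matchings_empty double_fact.simps)
  next
    case False
    then obtain a T where S: "S = insert a T" "a \<notin> T" by (meson Set.set_insert ex_in_conv)
    have T: "finite T" "card S = Suc (card T)" "odd (card T)" using S less.prems by auto
    have "card (matchings (T - {b})) = double_fact (int (card S) - 1 - 2)" if "b \<in> T" for b
    proof -
      have "Suc (card (T - {b})) = card T" using that T(1) by (metis card_Suc_Diff1)
      then have "card (T - {b}) < card S" and eq: "int (card (T - {b})) = int (card S) - 2"
        using T(2) by linarith+
      moreover have "even (card (T - {b}))"
        using \<open>Suc (card (T - {b})) = card T\<close> T(3) by (metis even_Suc)
      ultimately have "card (matchings (T - {b})) = double_fact (int (card (T - {b})) - 1)"
        using less.hyps[of "T - {b}"] T(1) by blast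
      then show ?thesis unfolding eq by (simp add: algebra_simps)
    qed
    then have "card (matchings S) = card T * double_fact (int (card S) - 1 - 2)"
      using card_restricted_matchings_insert[OF T(1) S(2), of "\<lambda>_. True"] S(1) by simp
    also have "\<dots> = double_fact (int (card S) - 1)"
      using T(2,3) by (subst (2) double_fact.simps) (auto elim: oddE)
    finally show ?thesis .
  qed
qed

lemma matchings_nonempty:
  assumes "finite S" "even (card S)"
  obtains P where "P \<in> matchings S"
proof -
  have "double_fact k > 0" for k
    by (induction k rule: double_fact.induct) (subst double_fact.simps, simp)
  then have "card (matchings S) > 0" unfolding card_matchings[OF assms] .
  then show ?thesis using that by (metis card_gt_0_iff ex_in_conv)
qed

text \<open>The matchings of \<open>S\<close> all of whose blocks join \<open>U\<close> to \<open>L\<close>. For \<open>S = X \<union> Y\<close> with \<open>X \<subseteq> U\<close>,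
  \<open>Y \<subseteq> L\<close> and \<open>U\<close>, \<open>L\<close> disjoint, these are the bijections from \<open>X\<close> to \<open>Y\<close>.\<close>

definition crossing_matchings :: "'a set \<Rightarrow> 'a set \<Rightarrow> 'a set \<Rightarrow> 'a set set set" where
  "crossing_matchings U L S = {P \<in> matchings S. \<forall>B\<in>P. B \<inter> U \<noteq> {} \<and> B \<inter> L \<noteq> {}}"

lemma card_crossing_matchings:
  assumes "finite X" "finite Y" "card X = card Y" "X \<subseteq> U" "Y \<subseteq> L" "U \<inter> L = {}"
  shows "card (crossing_matchings U L (X \<union> Y)) = fact (card X)"
  using assms
proof (induction X arbitrary: Y rule: finite_induct)
  case empty
  then have "crossing_matchings U L ({} \<union> Y) = {{}}"
    by (auto simp: crossing_matchings_def matchings_empty)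
  then show ?case by simp
next
  case (insert a X)
  let ?E = "\<lambda>B. B \<inter> U \<noteq> {} \<and> B \<inter> L \<noteq> {}"
  have aY: "a \<notin> X \<union> Y" "finite (X \<union> Y)" using insert by auto
  have "card (crossing_matchings U L (insert a (X \<union> Y)))
      = (\<Sum>b \<in> {b \<in> X \<union> Y. ?E {a, b}}. card (crossing_matchings U L (X \<union> Y - {b})))"
    unfolding crossing_matchings_def by (rule card_restricted_matchings_insert[OF aY(2,1)])
  also have "{b \<in> X \<union> Y. ?E {a, b}} = Y" using insert.prems by auto
  also have "(\<Sum>b\<in>Y. card (crossing_matchings U L (X \<union> Y - {b}))) = (\<Sum>b\<in>Y. fact (card X))"
  proof (rule sum.cong)
    fix b assume b: "b \<in> Y"
    then have "X \<union> Y - {b} = X \<union> (Y - {b})" using insert.prems by auto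
    moreover have "card X = card (Y - {b})"
      using insert.prems insert.hyps b by (metis card_Suc_Diff1 card_insert_disjoint nat.inject)
    ultimately show "card (crossing_matchings U L (X \<union> Y - {b})) = fact (card X)"
      using insert.IH[of "Y - {b}"] insert.prems by auto
  qed simp
  finally have "card (crossing_matchings U L (insert a (X \<union> Y))) = card Y * fact (card X)" by simp
  moreover have "card Y = Suc (card X)" using insert.prems insert.hyps by simp
  ultimately show ?case using insert.hyps by simp
qed

text \<open>A matching of \<open>U \<union> L\<close> consists of the blocks within \<open>U\<close>, the blocks within \<open>L\<close>, and the
  crossing blocks, whose ends in \<open>U\<close> and \<open>L\<close> form the sets \<open>X\<close> and \<open>Y\<close>.\<close>

lemma crossing_decomposition:
  fixes U L :: "'a set" and P
  defines "X \<equiv> U \<inter> \<Union>(crossing U L P)" and "Y \<equiv> L \<inter> \<Union>(crossing U L P)"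
  assumes P: "P \<in> matchings (U \<union> L)" and disj: "U \<inter> L = {}"
  shows "{B \<in> P. B \<subseteq> U} \<in> matchings (U - X)" "{B \<in> P. B \<subseteq> L} \<in> matchings (L - Y)"
    "crossing U L P \<in> crossing_matchings U L (X \<union> Y)"
    "P = {B \<in> P. B \<subseteq> U} \<union> {B \<in> P. B \<subseteq> L} \<union> crossing U L P"
proof -
  have cover: "\<Union>P = U \<union> L" using P unfolding matchings_iff by simp
  show eq: "P = {B \<in> P. B \<subseteq> U} \<union> {B \<in> P. B \<subseteq> L} \<union> crossing U L P"
    using cover disj unfolding crossing_def by blast
  have sub: "Q \<in> matchings (\<Union>Q)" if "Q \<subseteq> P" for Q
    using that P unfolding matchings_iff by (simp add: subset_iff)
  have unique: "B = C" if "B \<in> P" "C \<in> P" "x \<in> B" "x \<in> C" for B C x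
    using matchings_unique_block[OF P] that by blast
  have c1: "\<Union>(crossing U L P) = X \<union> Y" using cover unfolding X_def Y_def crossing_def by blast
  have not_crossing: "x \<notin> \<Union>(crossing U L P)" if "x \<in> B" "B \<in> P" "B \<subseteq> U \<or> B \<subseteq> L" for x B
    using that unique[of B _ x] disj unfolding crossing_def by blast
  have c2: "\<Union>{B \<in> P. B \<subseteq> U} = U - X"
  proof (intro equalityI subsetI)
    fix x assume "x \<in> U - X"
    then obtain B where "B \<in> P" "x \<in> B" "x \<in> U" "B \<notin> crossing U L P"
      using cover unfolding X_def by blast
    then show "x \<in> \<Union>{B \<in> P. B \<subseteq> U}" using cover unfolding crossing_def by blast
  qed (use not_crossing in \<open>auto simp: X_def\<close>)
  have c3: "\<Union>{B \<in> P. B \<subseteq> L} = L - Y"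
  proof (intro equalityI subsetI)
    fix x assume "x \<in> L - Y"
    then obtain B where "B \<in> P" "x \<in> B" "x \<in> L" "B \<notin> crossing U L P"
      using cover unfolding Y_def by blast
    then show "x \<in> \<Union>{B \<in> P. B \<subseteq> L}" using cover unfolding crossing_def by blast
  qed (use not_crossing in \<open>auto simp: Y_def\<close>)
  show "{B \<in> P. B \<subseteq> U} \<in> matchings (U - X)" using sub[of "{B \<in> P. B \<subseteq> U}"] c2 by auto
  show "{B \<in> P. B \<subseteq> L} \<in> matchings (L - Y)" using sub[of "{B \<in> P. B \<subseteq> L}"] c3 by auto
  have "crossing U L P \<subseteq> P" unfolding crossing_def by blast
  from sub[OF this] have "crossing U L P \<in> matchings (X \<union> Y)" unfolding c1 .
  then show "crossing U L P \<in> crossing_matchings U L (X \<union> Y)"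
    unfolding crossing_matchings_def by (simp add: crossing_def)
qed

lemma mate_crossing:
  assumes P: "P \<in> matchings (U \<union> L)" and disj: "U \<inter> L = {}"
  shows "bij_betw (mate P) (U \<inter> \<Union>(crossing U L P)) (L \<inter> \<Union>(crossing U L P))"
proof (rule bij_betw_byWitness[where f' = "mate P"])
  have inside: "mate P x \<in> L \<inter> \<Union>(crossing U L P)"
    if "x \<in> U \<inter> \<Union>(crossing U L P)" "U \<inter> L = {}" for U L x
  proof -
    from that obtain B where B: "B \<in> P" "x \<in> B" "B \<in> crossing U L P"
      unfolding crossing_def by blast
    then obtain y where y: "B = {x, y}" by (metis P matchings_block)
    have "mate P x = y" using mate_eq[OF P] B(1) y by blast
    moreover have "y \<in> L" using B(3) that unfolding y crossing_def by auto
    ultimately show ?thesis using B(3) y by auto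
  qed
  show "mate P ` (U \<inter> \<Union>(crossing U L P)) \<subseteq> L \<inter> \<Union>(crossing U L P)"
    using inside disj by blast
  show "mate P ` (L \<inter> \<Union>(crossing U L P)) \<subseteq> U \<inter> \<Union>(crossing U L P)"
    using inside[of _ L U] disj by (auto simp: crossing_commute[of L U])
qed (simp_all add: mate_mate[OF P])

lemma card_crossing:
  assumes P: "P \<in> matchings (U \<union> L)" and disj: "U \<inter> L = {}"
  shows "card (U \<inter> \<Union>(crossing U L P)) = card (crossing U L P)"
    "card (L \<inter> \<Union>(crossing U L P)) = card (crossing U L P)"
proof -
  let ?X = "U \<inter> \<Union>(crossing U L P)"
  note bij = mate_crossing[OF assms]
  have "bij_betw (\<lambda>x. {x, mate P x}) ?X (crossing U L P)"
  proof (rule bij_betw_imageI)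
    show "inj_on (\<lambda>x. {x, mate P x}) ?X"
      using bij_betwE[OF bij] disj by (intro inj_onI) (auto simp: doubleton_eq_iff)
    have block: "{x, mate P x} = B" if "x \<in> B" "B \<in> P" for x B
      using that mate_eq[OF P] by (metis P matchings_block)
    show "(\<lambda>x. {x, mate P x}) ` ?X = crossing U L P"
    proof (intro equalityI subsetI)
      fix B assume "B \<in> crossing U L P"
      then obtain x where "x \<in> B" "x \<in> U" "B \<in> P" "B \<in> crossing U L P"
        unfolding crossing_def by blast
      then show "B \<in> (\<lambda>x. {x, mate P x}) ` ?X" using block[of x B] by (intro image_eqI[of _ _ x]) auto
    next
      fix B assume "B \<in> (\<lambda>x. {x, mate P x}) ` ?X"
      then obtain x C where "x \<in> C" "C \<in> crossing U L P" "B = {x, mate P x}" by auto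
      moreover have "C \<in> P" using calculation(2) unfolding crossing_def by auto
      ultimately show "B \<in> crossing U L P" using block by auto
    qed
  qed
  then show 1: "card ?X = card (crossing U L P)" by (rule bij_betw_same_card)
  show "card (L \<inter> \<Union>(crossing U L P)) = card (crossing U L P)"
    using bij_betw_same_card[OF bij] 1 by simp
qed

lemma card_fixed_crossing_sides:
  assumes disj: "U \<inter> L = {}" and sub: "X \<subseteq> U" "Y \<subseteq> L"
  shows "card {P \<in> matchings (U \<union> L). U \<inter> \<Union>(crossing U L P) = X \<and> L \<inter> \<Union>(crossing U L P) = Y}
    = card (matchings (U - X)) * card (matchings (L - Y)) * card (crossing_matchings U L (X \<union> Y))"
proof -
  let ?F = "{P \<in> matchings (U \<union> L). U \<inter> \<Union>(crossing U L P) = X \<and> L \<inter> \<Union>(crossing U L P) = Y}"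
  let ?D = "matchings (U - X) \<times> matchings (L - Y) \<times> crossing_matchings U L (X \<union> Y)"
  let ?join = "\<lambda>(P1, P2, P3). P1 \<union> P2 \<union> P3"
  let ?split = "\<lambda>P. ({B \<in> P. B \<subseteq> U}, {B \<in> P. B \<subseteq> L}, crossing U L P)"
  have pieces: "?split (P1 \<union> P2 \<union> P3) = (P1, P2, P3)"
    if "P1 \<in> matchings (U - X)" "P2 \<in> matchings (L - Y)" "P3 \<in> crossing_matchings U L (X \<union> Y)"
    for P1 P2 P3
  proof -
    have 1: "B \<subseteq> U" "B \<noteq> {}" if "B \<in> P1" for B
      using matchings_block_subset[OF \<open>P1 \<in> _\<close> that] \<open>P1 \<in> _\<close> that unfolding matchings_iff by auto
    have 2: "B \<subseteq> L" "B \<noteq> {}" if "B \<in> P2" for B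
      using matchings_block_subset[OF \<open>P2 \<in> _\<close> that] \<open>P2 \<in> _\<close> that unfolding matchings_iff by auto
    have 3: "B \<inter> U \<noteq> {}" "B \<inter> L \<noteq> {}" if "B \<in> P3" for B
      using that \<open>P3 \<in> _\<close> unfolding crossing_matchings_def by auto
    have 4: "\<not> B \<subseteq> L" "B \<inter> L = {}" if "B \<in> P1" for B using 1[OF that] disj by blast+
    have 5: "\<not> B \<subseteq> U" "B \<inter> U = {}" if "B \<in> P2" for B using 2[OF that] disj by blast+
    have 6: "\<not> B \<subseteq> U" "\<not> B \<subseteq> L" if "B \<in> P3" for B using 3[OF that] disj by blast+
    have "{B \<in> P1 \<union> P2 \<union> P3. B \<subseteq> U} = P1" using 1(1) 5(1) 6(1) by auto
    moreover have "{B \<in> P1 \<union> P2 \<union> P3. B \<subseteq> L} = P2" using 2(1) 4(1) 6(2) by auto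
    moreover have "crossing U L (P1 \<union> P2 \<union> P3) = P3"
      using 3 4(2) 5(2) unfolding crossing_def by blast
    ultimately show ?thesis by simp
  qed
  have "bij_betw ?join ?D ?F"
  proof (rule bij_betw_byWitness[where f' = ?split])
    show "\<forall>a\<in>?D. ?split (?join a) = a" using pieces by auto
    show "\<forall>P\<in>?F. ?join (?split P) = P" using crossing_decomposition(4)[OF _ disj] by auto
    show "?split ` ?F \<subseteq> ?D" using crossing_decomposition(1-3)[OF _ disj] by fastforce
    show "?join ` ?D \<subseteq> ?F"
    proof clarify
      fix P1 P2 P3
      assume P: "P1 \<in> matchings (U - X)" "P2 \<in> matchings (L - Y)"
        "P3 \<in> crossing_matchings U L (X \<union> Y)"
      have P3: "P3 \<in> matchings (X \<union> Y)" using P(3) unfolding crossing_matchings_def by simp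
      have "(P1 \<union> P2) \<union> P3 \<in> matchings ((U - X) \<union> (L - Y) \<union> (X \<union> Y))"
        by (intro matchings_Un P(1,2) P3) (use disj sub in blast)+
      moreover have "(U - X) \<union> (L - Y) \<union> (X \<union> Y) = U \<union> L" using sub by blast
      moreover have "\<Union>(crossing U L (P1 \<union> P2 \<union> P3)) = X \<union> Y"
        using pieces[OF P] P3 unfolding matchings_iff by simp
      moreover have "U \<inter> (X \<union> Y) = X" "L \<inter> (X \<union> Y) = Y" using disj sub by blast+
      ultimately show "P1 \<union> P2 \<union> P3 \<in> matchings (U \<union> L)
          \<and> U \<inter> \<Union>(crossing U L (P1 \<union> P2 \<union> P3)) = X \<and> L \<inter> \<Union>(crossing U L (P1 \<union> P2 \<union> P3)) = Y"
        by simp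
    qed
  qed
  from bij_betw_same_card[OF this] show ?thesis by (simp add: card_cartesian_product)
qed

text \<open>The five factors count the choices of the crossing ends in \<open>U\<close> and in \<open>L\<close>, of a matching of
  the other points of \<open>U\<close> and of \<open>L\<close>, and of a bijection between the crossing ends.\<close>

lemma card_matchings_crossing:
  assumes fin: "finite U" "finite L" and disj: "U \<inter> L = {}"
    and q: "q \<le> card U" "q \<le> card L" and even: "even (card U - q)" "even (card L - q)"
  shows "card {P \<in> matchings (U \<union> L). card (crossing U L P) = q}
    = (card U choose q) * (card L choose q) * double_fact (int (card U) - int q - 1)
        * double_fact (int (card L) - int q - 1) * fact q"
proof -
  let ?F = "\<lambda>(X, Y). {P \<in> matchings (U \<union> L). U \<inter> \<Union>(crossing U L P) = X \<and> L \<inter> \<Union>(crossing U L P) = Y}"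
  let ?I = "{X. X \<subseteq> U \<and> card X = q} \<times> {Y. Y \<subseteq> L \<and> card Y = q}"
  let ?c = "double_fact (int (card U) - int q - 1) * double_fact (int (card L) - int q - 1) * fact q"
  have finI: "finite ?I" using fin by simp
  have eq: "{P \<in> matchings (U \<union> L). card (crossing U L P) = q} = (\<Union>p\<in>?I. ?F p)"
    using card_crossing[OF _ disj] by auto
  have "card {P \<in> matchings (U \<union> L). card (crossing U L P) = q} = (\<Sum>p\<in>?I. card (?F p))"
    unfolding eq by (rule card_UN_disjoint[OF finI]) (use finite_matchings[of "U \<union> L"] fin in auto)
  also have "\<dots> = (\<Sum>p\<in>?I. ?c)"
  proof (rule sum.cong[OF refl])
    fix p assume "p \<in> ?I"
    then obtain X Y where p: "p = (X, Y)" and XY: "X \<subseteq> U" "Y \<subseteq> L" "card X = q" "card Y = q" by auto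
    then have finXY: "finite X" "finite Y" using fin finite_subset by blast+
    have cards: "card (U - X) = card U - q" "card (L - Y) = card L - q"
      using XY finXY by (simp_all add: card_Diff_subset)
    have "card (matchings (U - X)) = double_fact (int (card U) - int q - 1)"
      using card_matchings[of "U - X"] fin even q by (simp add: cards of_nat_diff)
    moreover have "card (matchings (L - Y)) = double_fact (int (card L) - int q - 1)"
      using card_matchings[of "L - Y"] fin even q by (simp add: cards of_nat_diff)
    moreover have "card (crossing_matchings U L (X \<union> Y)) = fact q"
      using card_crossing_matchings[OF finXY _ XY(1,2) disj] XY by simp
    ultimately show "card (?F p) = ?c" using card_fixed_crossing_sides[OF disj XY(1,2)] unfolding p by simp
  qed
  also have "\<dots> = card ?I * ?c" by simp
  also have "card ?I = (card U choose q) * (card L choose q)"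
    using fin by (simp add: card_cartesian_product n_subsets)
  finally show ?thesis by (simp add: algebra_simps)
qed

text \<open>A matching of \<open>U - X\<close> and an injection of \<open>X\<close> into \<open>L\<close> extend to a matching of \<open>U \<union> L\<close>
  without further crossing blocks, since an even number of points of \<open>L\<close> is left over.\<close>

lemma matching_extension:
  assumes fin: "finite U" "finite L" and disj: "U \<inter> L = {}"
    and g: "X \<subseteq> U" "inj_on g X" "g ` X \<subseteq> L"
    and P: "P \<in> matchings (U - X)" and even: "even (card L - card X)"
  obtains Q where "Q \<in> matchings (U \<union> L)" "P \<subseteq> Q" "\<And>x. x \<in> X \<Longrightarrow> {x, g x} \<in> Q"
    "card (crossing U L Q) = card X"
proof -
  have finX: "finite X" using fin g finite_subset by blast
  have "card (L - g ` X) = card L - card X"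
    using g finX by (simp add: card_Diff_subset card_image)
  then obtain R where R: "R \<in> matchings (L - g ` X)"
    using matchings_nonempty[of "L - g ` X"] fin even by auto
  let ?T = "(\<lambda>x. {x, g x}) ` X"
  have T: "?T \<in> matchings (X \<union> g ` X)"
  proof -
    have "x \<noteq> g y" if "x \<in> X" "y \<in> X" for x y using that disj g by blast
    then show ?thesis using g(2) unfolding matchings_iff inj_on_def by (auto simp: card_2_iff)
  qed
  have Q: "P \<union> R \<union> ?T \<in> matchings ((U - X) \<union> (L - g ` X) \<union> (X \<union> g ` X))"
    by (intro matchings_Un P R T) (use disj g in blast)+
  moreover have "(U - X) \<union> (L - g ` X) \<union> (X \<union> g ` X) = U \<union> L" using g by blast
  moreover have "crossing U L (P \<union> R \<union> ?T) = ?T"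
  proof -
    have "B \<notin> crossing U L (P \<union> R \<union> ?T)" if "B \<in> P" for B
      using matchings_block_subset[OF P that] disj unfolding crossing_def by blast
    moreover have "B \<notin> crossing U L (P \<union> R \<union> ?T)" if "B \<in> R" for B
      using matchings_block_subset[OF R that] disj unfolding crossing_def by blast
    moreover have "B \<in> crossing U L (P \<union> R \<union> ?T)" if "B \<in> ?T" for B
      using that g unfolding crossing_def by blast
    moreover have "crossing U L (P \<union> R \<union> ?T) \<subseteq> P \<union> R \<union> ?T" unfolding crossing_def by blast
    ultimately show ?thesis by blast
  qed
  moreover have "card ?T = card X"
  proof (rule card_image, rule inj_onI)
    fix x y assume "x \<in> X" "y \<in> X" "{x, g x} = {y, g y}"
    then show "x = y" using disj g by (auto simp: doubleton_eq_iff)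
  qed
  ultimately show ?thesis by (intro that[of "P \<union> R \<union> ?T"]) auto
qed

section \<open>Products of Brauer partitions\<close>

text \<open>The three rows of points of a product graph.\<close>

definition tops :: "nat \<Rightarrow> point set" where "tops m = Plain ` {1..m}"
definition bots :: "nat \<Rightarrow> point set" where "bots n = Prime ` {1..n}"
definition mids :: "nat \<Rightarrow> point set" where "mids n = DPrime ` {1..n}"

lemma sides_simps [simp]:
  "finite (tops m)" "finite (bots n)" "finite (mids n)"
  "card (tops m) = m" "card (bots n) = n"
  "tops m \<inter> bots n = {}" "bots n \<inter> tops m = {}"
  "tops m \<inter> mids n = {}" "mids n \<inter> tops m = {}"
  "mids n \<inter> bots m = {}" "bots m \<inter> mids n = {}"
  by (auto simp: tops_def bots_def mids_def card_image inj_on_def)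

lemma brauer_eq: "brauer m n = matchings (tops m \<union> bots n)"
  unfolding brauer_def matchings_def points_def tops_def bots_def ..

lemma brauer_eq': "brauer m n = matchings (bots n \<union> tops m)"
  unfolding brauer_eq by (simp add: Un_commute)

lemma brank_eq: "brank m n \<alpha> = card (crossing (tops m) (bots n) \<alpha>)"
  unfolding brank_def crossing_def tops_def bots_def ..

lemma brank_eq': "brank m n \<alpha> = card (crossing (bots n) (tops m) \<alpha>)"
  unfolding brank_eq by (simp add: crossing_commute)

lemma bprod_eq:
  "bprod m k \<alpha> \<beta> = outer_components (tops m \<union> bots k) ((`) lower_to_middle ` \<alpha> \<union> (`) upper_to_middle ` \<beta>)"
  unfolding bprod_def outer_components_def product_graph_def block_rel_def points_def tops_def bots_def ..

lemma lower_matching: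
  assumes "\<alpha> \<in> brauer m n"
  shows "(`) lower_to_middle ` \<alpha> \<in> matchings (tops m \<union> mids n)"
proof -
  have "lower_to_middle ` (tops m \<union> bots n) = tops m \<union> mids n"
    unfolding tops_def bots_def mids_def by (simp add: image_Un image_image)
  moreover have "inj_on lower_to_middle (tops m \<union> bots n)"
    unfolding tops_def bots_def inj_on_def by auto
  ultimately show ?thesis using matchings_image assms unfolding brauer_eq by metis
qed

lemma upper_matching:
  assumes "\<beta> \<in> brauer n k"
  shows "(`) upper_to_middle ` \<beta> \<in> matchings (mids n \<union> bots k)"
proof -
  have "upper_to_middle ` (tops n \<union> bots k) = mids n \<union> bots k"
    unfolding tops_def bots_def mids_def by (simp add: image_Un image_image)
  moreover have "inj_on upper_to_middle (tops n \<union> bots k)"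
    unfolding tops_def bots_def inj_on_def by auto
  ultimately show ?thesis using matchings_image assms unfolding brauer_eq by metis
qed

lemma bprod_brauer:
  assumes "\<alpha> \<in> brauer m n" "\<beta> \<in> brauer n k"
  shows "bprod m k \<alpha> \<beta> \<in> brauer m k"
  unfolding bprod_eq brauer_eq
  by (rule outer_matching[OF lower_matching[OF assms(1)] upper_matching[OF assms(2)]]) simp_all

lemma finite_brauer: "finite (brauer m n)"
  unfolding brauer_eq by (rule finite_matchings) simp

lemma brank_bprod_le_left:
  assumes "\<alpha> \<in> brauer m n" "\<beta> \<in> brauer n k"
  shows "brank m k (bprod m k \<alpha> \<beta>) \<le> brank m n \<alpha>"
proof -
  have fin: "finite (crossing (tops m) (bots n) \<alpha>)"
    using finite_matching[OF _ assms(1)[unfolded brauer_eq]] unfolding crossing_def by simp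
  have "brank m k (bprod m k \<alpha> \<beta>) \<le> card (crossing (tops m) (mids n) ((`) lower_to_middle ` \<alpha>))"
    unfolding bprod_eq brank_eq
    by (rule card_crossing_outer_le[OF lower_matching[OF assms(1)] upper_matching[OF assms(2)]]) simp_all
  also have "crossing (tops m) (mids n) ((`) lower_to_middle ` \<alpha>)
      \<subseteq> (`) lower_to_middle ` crossing (tops m) (bots n) \<alpha>"
  proof
    fix C assume "C \<in> crossing (tops m) (mids n) ((`) lower_to_middle ` \<alpha>)"
    then obtain B x y where B: "B \<in> \<alpha>" "C = lower_to_middle ` B"
      and "x \<in> B" "lower_to_middle x \<in> tops m" "y \<in> B" "lower_to_middle y \<in> mids n"
      unfolding crossing_def by blast
    moreover have "B \<subseteq> tops m \<union> bots n"
      using matchings_block_subset B(1) assms(1) unfolding brauer_eq by blast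
    ultimately have "x \<in> tops m" "y \<in> bots n"
      by (auto simp: tops_def bots_def mids_def)
    with B \<open>x \<in> B\<close> \<open>y \<in> B\<close> show "C \<in> (`) lower_to_middle ` crossing (tops m) (bots n) \<alpha>"
      unfolding crossing_def by blast
  qed
  then have "card (crossing (tops m) (mids n) ((`) lower_to_middle ` \<alpha>)) \<le> brank m n \<alpha>"
    unfolding brank_eq by (rule surj_card_le[OF fin])
  finally show ?thesis .
qed

lemma brank_bprod_le_right:
  assumes "\<alpha> \<in> brauer m n" "\<beta> \<in> brauer n k"
  shows "brank m k (bprod m k \<alpha> \<beta>) \<le> brank n k \<beta>"
proof -
  have fin: "finite (crossing (tops n) (bots k) \<beta>)"
    using finite_matching[OF _ assms(2)[unfolded brauer_eq]] unfolding crossing_def by simp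
  have "card (crossing (bots k) (tops m)
        (outer_components (bots k \<union> tops m) ((`) upper_to_middle ` \<beta> \<union> (`) lower_to_middle ` \<alpha>)))
      \<le> card (crossing (bots k) (mids n) ((`) upper_to_middle ` \<beta>))"
    by (rule card_crossing_outer_le)
      (use lower_matching[OF assms(1)] upper_matching[OF assms(2)] in \<open>simp_all add: Un_commute Int_commute\<close>)
  then have "brank m k (bprod m k \<alpha> \<beta>) \<le> card (crossing (mids n) (bots k) ((`) upper_to_middle ` \<beta>))"
    unfolding bprod_eq brank_eq by (simp add: Un_commute crossing_commute)
  also have "crossing (mids n) (bots k) ((`) upper_to_middle ` \<beta>)
      \<subseteq> (`) upper_to_middle ` crossing (tops n) (bots k) \<beta>"
  proof
    fix C assume "C \<in> crossing (mids n) (bots k) ((`) upper_to_middle ` \<beta>)"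
    then obtain B x y where B: "B \<in> \<beta>" "C = upper_to_middle ` B"
      and "x \<in> B" "upper_to_middle x \<in> mids n" "y \<in> B" "upper_to_middle y \<in> bots k"
      unfolding crossing_def by blast
    moreover have "B \<subseteq> tops n \<union> bots k"
      using matchings_block_subset B(1) assms(2) unfolding brauer_eq by blast
    ultimately have "x \<in> tops n" "y \<in> bots k"
      by (auto simp: tops_def bots_def mids_def)
    with B \<open>x \<in> B\<close> \<open>y \<in> B\<close> show "C \<in> (`) upper_to_middle ` crossing (tops n) (bots k) \<beta>"
      unfolding crossing_def by blast
  qed
  then have "card (crossing (mids n) (bots k) ((`) upper_to_middle ` \<beta>)) \<le> brank n k \<beta>"
    unfolding brank_eq by (rule surj_card_le[OF fin])
  finally show ?thesis .
qed

text \<open>The reflection that exchanges \<open>x\<close> and \<open>x'\<close>. The lower point \<open>flip a\<close> of the first factor is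
  identified with the upper point \<open>a\<close> of the second factor in the product graph.\<close>

fun flip :: "point \<Rightarrow> point" where
  "flip (Plain x) = Prime x"
| "flip (Prime x) = Plain x"
| "flip (DPrime x) = DPrime x"

lemma flip_flip [simp]: "flip (flip x) = x"
  by (cases x) auto

lemma inj_flip: "inj_on flip S"
  by (metis flip_flip inj_onI)

lemma flip_tops: "x \<in> tops m \<Longrightarrow> flip x \<in> bots m" and flip_bots: "x \<in> bots m \<Longrightarrow> flip x \<in> tops m"
  unfolding tops_def bots_def by auto

lemma middle_flip: "x \<in> tops n \<Longrightarrow> lower_to_middle (flip x) = upper_to_middle x"
  "x \<in> bots n \<Longrightarrow> lower_to_middle x = upper_to_middle (flip x)"
  unfolding tops_def bots_def by auto

lemma middle_id: "x \<in> tops n \<Longrightarrow> lower_to_middle x = x" "x \<in> bots n \<Longrightarrow> upper_to_middle x = x"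
  unfolding tops_def bots_def by auto

text \<open>The remaining facts on products exhibit blocks of \<open>\<alpha>\<beta>\<close> by short paths in the product graph.\<close>

context
  fixes m n k :: nat and \<alpha> \<beta> :: "point set set"
  assumes \<alpha>: "\<alpha> \<in> brauer m n" and \<beta>: "\<beta> \<in> brauer n k"
begin

lemma bprod_block:
  assumes "(x, y) \<in> (product_graph \<alpha> \<beta>)\<^sup>*" "x \<in> tops m \<union> bots k" "y \<in> tops m \<union> bots k" "x \<noteq> y"
  shows "{x, y} \<in> bprod m k \<alpha> \<beta>"
proof -
  let ?r = "{(x, y). x \<in> points m k \<and> y \<in> points m k \<and> (x, y) \<in> (product_graph \<alpha> \<beta>)\<^sup>*}"
  have xy: "x \<in> points m k" "y \<in> points m k"
    using assms(2,3) unfolding points_def tops_def bots_def by auto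
  then have C: "?r `` {x} \<in> bprod m k \<alpha> \<beta>" unfolding bprod_def by (intro quotientI)
  have "bprod m k \<alpha> \<beta> \<in> matchings (tops m \<union> bots k)"
    using bprod_brauer[OF \<alpha> \<beta>] unfolding brauer_eq .
  moreover have "x \<in> ?r `` {x}" "y \<in> ?r `` {x}" using xy assms(1) by auto
  moreover obtain z where "?r `` {x} = {x, z}" using calculation(1) C calculation(2) by (rule matchings_block)
  ultimately have "?r `` {x} = {x, y}" using assms(4) by (metis insertE singletonD)
  then show ?thesis using C by simp
qed

lemma upper_edge: "{x, y} \<in> \<alpha> \<Longrightarrow> (lower_to_middle x, lower_to_middle y) \<in> product_graph \<alpha> \<beta>"
  unfolding product_graph_def by (auto intro!: bexI[of _ "lower_to_middle ` {x, y}"])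

lemma lower_edge: "{x, y} \<in> \<beta> \<Longrightarrow> (upper_to_middle x, upper_to_middle y) \<in> product_graph \<alpha> \<beta>"
  unfolding product_graph_def by (auto intro!: bexI[of _ "upper_to_middle ` {x, y}"])

lemma bprod_upper:
  assumes "{x, y} \<in> \<alpha>" "x \<in> tops m" "y \<in> tops m" "x \<noteq> y"
  shows "{x, y} \<in> bprod m k \<alpha> \<beta>"
  using upper_edge[OF assms(1)] assms by (intro bprod_block) (auto simp: middle_id)

lemma bprod_lower:
  assumes "{x, y} \<in> \<beta>" "x \<in> bots k" "y \<in> bots k" "x \<noteq> y"
  shows "{x, y} \<in> bprod m k \<alpha> \<beta>"
  using lower_edge[OF assms(1)] assms by (intro bprod_block) (auto simp: middle_id)

lemma bprod_transversal:
  assumes "{x, flip a} \<in> \<alpha>" "{a, y} \<in> \<beta>" "x \<in> tops m" "a \<in> tops n" "y \<in> bots k"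
  shows "{x, y} \<in> bprod m k \<alpha> \<beta>"
proof (rule bprod_block)
  have "(x, upper_to_middle a) \<in> product_graph \<alpha> \<beta>" "(upper_to_middle a, y) \<in> product_graph \<alpha> \<beta>"
    using upper_edge[OF assms(1)] lower_edge[OF assms(2)] assms(3-) by (simp_all add: middle_id middle_flip)
  then show "(x, y) \<in> (product_graph \<alpha> \<beta>)\<^sup>*" by auto
  show "x \<noteq> y" using assms(3,5) unfolding tops_def bots_def by auto
qed (use assms in auto)

lemma bprod_joined_upper:
  assumes "{x, flip a} \<in> \<alpha>" "{y, flip b} \<in> \<alpha>" "{a, b} \<in> \<beta>"
    and "x \<in> tops m" "y \<in> tops m" "a \<in> tops n" "b \<in> tops n" "x \<noteq> y"
  shows "{x, y} \<in> bprod m k \<alpha> \<beta>"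
proof (rule bprod_block)
  have "{flip b, y} \<in> \<alpha>" using assms(2) by (simp add: insert_commute)
  then have "(x, upper_to_middle a) \<in> product_graph \<alpha> \<beta>"
    "(upper_to_middle a, upper_to_middle b) \<in> product_graph \<alpha> \<beta>"
    "(upper_to_middle b, y) \<in> product_graph \<alpha> \<beta>"
    using upper_edge[OF assms(1)] lower_edge[OF assms(3)] upper_edge[of "flip b" y] assms(4-)
    by (simp_all add: middle_id middle_flip)
  then show "(x, y) \<in> (product_graph \<alpha> \<beta>)\<^sup>*" by (meson r_into_rtrancl rtrancl.rtrancl_into_rtrancl)
qed (use assms in auto)

lemma bprod_joined_lower:
  assumes "{x, flip c} \<in> \<beta>" "{y, flip d} \<in> \<beta>" "{c, d} \<in> \<alpha>"
    and "x \<in> bots k" "y \<in> bots k" "c \<in> bots n" "d \<in> bots n" "x \<noteq> y"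
  shows "{x, y} \<in> bprod m k \<alpha> \<beta>"
proof (rule bprod_block)
  have "{flip d, y} \<in> \<beta>" using assms(2) by (simp add: insert_commute)
  then have "(x, lower_to_middle c) \<in> product_graph \<alpha> \<beta>"
    "(lower_to_middle c, lower_to_middle d) \<in> product_graph \<alpha> \<beta>"
    "(lower_to_middle d, y) \<in> product_graph \<alpha> \<beta>"
    using lower_edge[OF assms(1)] upper_edge[OF assms(3)] lower_edge[of "flip d" y] assms(4-)
    by (simp_all add: middle_id middle_flip)
  then show "(x, y) \<in> (product_graph \<alpha> \<beta>)\<^sup>*" by (meson r_into_rtrancl rtrancl.rtrancl_into_rtrancl)
qed (use assms in auto)

end

section \<open>Factorization in the sandwich semigroup\<close>

lemma even_card_noncrossing:
  assumes P: "P \<in> matchings (U \<union> L)" and disj: "U \<inter> L = {}" and fin: "finite U"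
  shows "card (crossing U L P) \<le> card U" "even (card U - card (crossing U L P))"
proof -
  let ?X = "U \<inter> \<Union>(crossing U L P)"
  have cX: "card ?X = card (crossing U L P)" by (rule card_crossing(1)[OF P disj])
  then show "card (crossing U L P) \<le> card U" using fin by (metis Int_lower1 card_mono)
  have "card (U - ?X) = card U - card (crossing U L P)"
    using fin cX by (simp add: card_Diff_subset)
  then show "even (card U - card (crossing U L P))"
    using card_matching[OF _ crossing_decomposition(1)[OF P disj]] fin by (metis dvd_triv_left finite_Diff)
qed

lemma noncrossing_block:
  assumes P: "P \<in> matchings (U \<union> L)" and disj: "U \<inter> L = {}" and fin: "finite U"
    and less: "card (crossing U L P) < card U"
  obtains x y where "{x, y} \<in> P" "x \<noteq> y" "x \<in> U - \<Union>(crossing U L P)" "y \<in> U - \<Union>(crossing U L P)"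
proof -
  let ?X = "U \<inter> \<Union>(crossing U L P)"
  note M = crossing_decomposition(1)[OF P disj]
  have "?X \<noteq> U" using card_crossing(1)[OF P disj] less by auto
  then obtain x where x: "x \<in> U - ?X" by blast
  with M obtain y where "{x, y} \<in> {B \<in> P. B \<subseteq> U}" "y \<in> U - ?X" "y \<noteq> x" by (rule matchings_cover)
  with x show ?thesis by (intro that[of x y]) auto
qed

text \<open>Every \<open>\<gamma>\<close> of rank at most \<open>rank \<sigma> < n \<le> m\<close> is a product \<open>\<alpha> \<star> \<beta>\<close> of two elements whose rank
  is larger by two. There are upper blocks \<open>{x, y}\<close> of \<open>\<gamma>\<close> and \<open>{a, b}\<close> of \<open>\<sigma>\<close>, and lower blocks
  \<open>{u, v}\<close> of \<open>\<gamma>\<close> and \<open>{c, d}\<close> of \<open>\<sigma>\<close>. The factor \<open>\<alpha>\<close> keeps the upper blocks of \<open>\<gamma>\<close> except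
  \<open>{x, y}\<close>, sends \<open>x\<close> and \<open>y\<close> to \<open>a\<close> and \<open>b\<close>, and leads the transversals of \<open>\<gamma>\<close> to distinct
  transversals of \<open>\<sigma>\<close>. Dually, \<open>\<beta>\<close> keeps the lower blocks of \<open>\<gamma>\<close> except \<open>{u, v}\<close>, joins \<open>u\<close> and
  \<open>v\<close> to \<open>c\<close> and \<open>d\<close>, and leads these transversals of \<open>\<sigma>\<close> to the lower ends of the transversals
  of \<open>\<gamma>\<close>. The middle points left over are matched arbitrarily.\<close>

lemma sandwich_factorization:
  assumes \<sigma>: "\<sigma> \<in> brauer n m" and r: "brank n m \<sigma> < n" "n \<le> m"
    and \<gamma>: "\<gamma> \<in> brauer m n" "brank m n \<gamma> \<le> brank n m \<sigma>"
  obtains \<alpha> \<beta> where "\<alpha> \<in> brauer m n" "\<beta> \<in> brauer m n"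
    "brank m n \<alpha> = brank m n \<gamma> + 2" "brank m n \<beta> = brank m n \<gamma> + 2" "\<gamma> = sandwich m n \<sigma> \<alpha> \<beta>"
proof -
  define q where "q = brank m n \<gamma>"
  define T where "T = \<Union>(crossing (tops m) (bots n) \<gamma>)"
  define S where "S = \<Union>(crossing (tops n) (bots m) \<sigma>)"
  have \<gamma>M: "\<gamma> \<in> matchings (tops m \<union> bots n)" and \<sigma>M: "\<sigma> \<in> matchings (tops n \<union> bots m)"
    using \<gamma> \<sigma> unfolding brauer_eq by auto
  have \<gamma>M': "\<gamma> \<in> matchings (bots n \<union> tops m)" and \<sigma>M': "\<sigma> \<in> matchings (bots m \<union> tops n)"
    using \<gamma> \<sigma> unfolding brauer_eq' by auto
  have T': "T = \<Union>(crossing (bots n) (tops m) \<gamma>)" and S': "S = \<Union>(crossing (bots m) (tops n) \<sigma>)"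
    unfolding T_def S_def by (simp_all add: crossing_commute)
  have q: "q < n" "q < m" using r \<gamma>(2) unfolding q_def by auto
  \<comment> \<open>Since \<open>rank \<gamma> \<le> rank \<sigma> < n \<le> m\<close>, both partitions have a block within each of their two rows.\<close>
  obtain x y where xy: "{x, y} \<in> \<gamma>" "x \<noteq> y" "x \<in> tops m - T" "y \<in> tops m - T"
    using noncrossing_block[OF \<gamma>M] q unfolding T_def q_def brank_eq by auto
  obtain u v where uv: "{u, v} \<in> \<gamma>" "u \<noteq> v" "u \<in> bots n - T" "v \<in> bots n - T"
    using noncrossing_block[OF \<gamma>M'] q unfolding T' q_def brank_eq' by auto
  obtain a b where ab: "{a, b} \<in> \<sigma>" "a \<noteq> b" "a \<in> tops n - S" "b \<in> tops n - S"
    using noncrossing_block[OF \<sigma>M] r unfolding S_def brank_eq by auto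
  obtain c d where cd: "{c, d} \<in> \<sigma>" "c \<noteq> d" "c \<in> bots m - S" "d \<in> bots m - S"
    using noncrossing_block[OF \<sigma>M'] r unfolding S' brank_eq' by auto
  define X where "X = tops m \<inter> T"
  define Y where "Y = bots n \<inter> T"
  have fin: "finite X" "finite Y" unfolding X_def Y_def by auto
  have cards: "card X = q" "card Y = q"
    using card_crossing[OF \<gamma>M] unfolding X_def Y_def T_def q_def brank_eq by auto
  have \<gamma>bij: "bij_betw (mate \<gamma>) X Y"
    using mate_crossing[OF \<gamma>M] unfolding X_def Y_def T_def by simp
  have \<sigma>bij: "bij_betw (mate \<sigma>) (tops n \<inter> S) (bots m \<inter> S)"
    using mate_crossing[OF \<sigma>M] unfolding S_def by simp
  have "card X \<le> card (tops n \<inter> S)"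
    using card_crossing(1)[OF \<sigma>M] \<gamma>(2) cards unfolding S_def q_def brank_eq by simp
  then obtain e where e: "e ` X \<subseteq> tops n \<inter> S" "inj_on e X"
    using card_le_inj[of X "tops n \<inter> S"] fin by auto
  \<comment> \<open>\<open>e\<close> selects a transversal of \<open>\<sigma>\<close> for each transversal of \<open>\<gamma>\<close>, both given by their upper ends.
    \<open>e1\<close> and \<open>e2\<close> are the attaching maps of \<open>\<alpha>\<close> and \<open>\<beta>\<close>, with values in the upper and the lower
    row of \<open>\<sigma>\<close>.\<close>
  define e1 where "e1 = e(x := a, y := b)"
  define e2 where "e2 = (mate \<sigma> \<circ> e \<circ> mate \<gamma>)(u := c, v := d)"
  have \<gamma>inv: "mate \<gamma> w \<in> X" if "w \<in> Y" for w
    using that \<gamma>bij mate_mate[OF \<gamma>M] by (metis bij_betw_imp_surj_on imageE)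
  have notin: "x \<notin> X" "y \<notin> X" "u \<notin> Y" "v \<notin> Y" using xy uv unfolding X_def Y_def by auto
  have e1X: "e1 z = e z" if "z \<in> X" for z using that notin unfolding e1_def by auto
  have e1xy: "e1 x = a" "e1 y = b" using xy(2) unfolding e1_def by auto
  have e2Y: "e2 w = mate \<sigma> (e (mate \<gamma> w))" if "w \<in> Y" for w using that notin unfolding e2_def by auto
  have e2uv: "e2 u = c" "e2 v = d" using uv(2) unfolding e2_def by auto
  have \<sigma>e: "mate \<sigma> (e z) \<in> bots m \<inter> S" if "z \<in> X" for z
    using that e(1) bij_betwE[OF \<sigma>bij] by blast
  have inj1: "inj_on e1 (X \<union> {x, y})"
  proof -
    have "a \<notin> e1 ` X" "b \<notin> e1 ` X" using e1X e(1) ab by auto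
    moreover have "inj_on e1 X" using e(2) e1X by (simp add: inj_on_def)
    ultimately show ?thesis using e1xy ab(2) by (auto simp: inj_on_insert)
  qed
  have inj2: "inj_on e2 (Y \<union> {u, v})"
  proof -
    have "c \<notin> e2 ` Y" "d \<notin> e2 ` Y" using e2Y \<sigma>e[OF \<gamma>inv] cd by auto
    moreover have "inj_on e2 Y"
      using e(2) e2Y \<gamma>inv mate_mate[OF \<gamma>M] mate_mate[OF \<sigma>M] by (smt (verit) inj_on_def)
    ultimately show ?thesis using e2uv cd(2) by (auto simp: inj_on_insert)
  qed
  have img1: "e1 z \<in> tops n" if "z \<in> X \<union> {x, y}" for z using that e(1) e1X e1xy ab by auto
  have img2: "e2 w \<in> bots m" if "w \<in> Y \<union> {u, v}" for w
    using that e2Y \<sigma>e[OF \<gamma>inv] e2uv cd by auto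
  have cards': "card (X \<union> {x, y}) = q + 2" "card (Y \<union> {u, v}) = q + 2"
    using fin cards notin xy(2) uv(2) by simp_all
  have evens: "even (n - q)" "even (m - q)"
    using even_card_noncrossing(2)[OF \<gamma>M] even_card_noncrossing(2)[OF \<gamma>M']
    unfolding q_def brank_eq by (simp_all add: crossing_commute)
  have diff_diff: "V - W - Z = V - (W \<union> Z)" for V W Z :: "point set" by blast
  have "{B \<in> \<gamma>. B \<subseteq> tops m} - {{x, y}} \<in> matchings (tops m - X - {x, y})"
    using crossing_decomposition(1)[OF \<gamma>M] xy unfolding X_def T_def by (intro matchings_remove) auto
  then have PU: "{B \<in> \<gamma>. B \<subseteq> tops m} - {{x, y}} \<in> matchings (tops m - (X \<union> {x, y}))"
    unfolding diff_diff .
  have "{B \<in> \<gamma>. B \<subseteq> bots n} - {{u, v}} \<in> matchings (bots n - Y - {u, v})"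
    using crossing_decomposition(2)[OF \<gamma>M] uv unfolding Y_def T_def by (intro matchings_remove) auto
  then have PL: "{B \<in> \<gamma>. B \<subseteq> bots n} - {{u, v}} \<in> matchings (bots n - (Y \<union> {u, v}))"
    unfolding diff_diff .
  obtain \<alpha> where \<alpha>: "\<alpha> \<in> matchings (tops m \<union> bots n)" "{B \<in> \<gamma>. B \<subseteq> tops m} - {{x, y}} \<subseteq> \<alpha>"
    "\<And>z. z \<in> X \<union> {x, y} \<Longrightarrow> {z, flip (e1 z)} \<in> \<alpha>"
    "card (crossing (tops m) (bots n) \<alpha>) = q + 2"
  proof (rule matching_extension[of "tops m" "bots n" "X \<union> {x, y}" "flip \<circ> e1", OF _ _ _ _ _ _ PU])
    show "X \<union> {x, y} \<subseteq> tops m" using xy unfolding X_def by auto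
    show "inj_on (flip \<circ> e1) (X \<union> {x, y})" by (rule comp_inj_on[OF inj1 inj_flip])
    show "(flip \<circ> e1) ` (X \<union> {x, y}) \<subseteq> bots n" using img1 flip_tops by auto
    show "even (card (bots n) - card (X \<union> {x, y}))" using evens q unfolding cards' by auto
  qed (use cards' in auto)
  obtain \<beta> where \<beta>: "\<beta> \<in> matchings (bots n \<union> tops m)" "{B \<in> \<gamma>. B \<subseteq> bots n} - {{u, v}} \<subseteq> \<beta>"
    "\<And>w. w \<in> Y \<union> {u, v} \<Longrightarrow> {w, flip (e2 w)} \<in> \<beta>"
    "card (crossing (bots n) (tops m) \<beta>) = q + 2"
  proof (rule matching_extension[of "bots n" "tops m" "Y \<union> {u, v}" "flip \<circ> e2", OF _ _ _ _ _ _ PL])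
    show "Y \<union> {u, v} \<subseteq> bots n" using uv unfolding Y_def by auto
    show "inj_on (flip \<circ> e2) (Y \<union> {u, v})" by (rule comp_inj_on[OF inj2 inj_flip])
    show "(flip \<circ> e2) ` (Y \<union> {u, v}) \<subseteq> tops m" using img2 flip_bots by auto
    show "even (card (tops m) - card (Y \<union> {u, v}))" using evens q unfolding cards' by auto
  qed (use cards' in auto)
  have \<alpha>B: "\<alpha> \<in> brauer m n" and \<beta>B: "\<beta> \<in> brauer m n"
    using \<alpha>(1) \<beta>(1) unfolding brauer_eq by (simp_all add: Un_commute)
  let ?\<delta> = "bprod m m \<alpha> \<sigma>"
  have \<delta>B: "?\<delta> \<in> brauer m m" by (rule bprod_brauer[OF \<alpha>B \<sigma>])
  have xy\<delta>: "{x, y} \<in> ?\<delta>"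
    by (rule bprod_joined_upper[OF \<alpha>B \<sigma> _ _ ab(1)]) (use \<alpha>(3)[of x] \<alpha>(3)[of y] e1xy xy ab in auto)
  have cd\<delta>: "{c, d} \<in> ?\<delta>" by (rule bprod_lower[OF \<alpha>B \<sigma> cd(1)]) (use cd in auto)
  have trans\<delta>: "{z, mate \<sigma> (e z)} \<in> ?\<delta>" if z: "z \<in> X" for z
  proof (rule bprod_transversal[OF \<alpha>B \<sigma>])
    show "{z, flip (e z)} \<in> \<alpha>" using \<alpha>(3)[of z] z e1X by simp
    have "e z \<in> tops n" using e(1) z by blast
    then show "e z \<in> tops n" "{e z, mate \<sigma> (e z)} \<in> \<sigma>" using mate_inside(3)[OF \<sigma>M] by auto
  qed (use z \<sigma>e X_def in auto)
  \<comment> \<open>Two matchings of the same set are equal as soon as one contains the other.\<close>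
  have block: "B \<in> bprod m n ?\<delta> \<beta>" if B: "B \<in> \<gamma>" for B
  proof -
    have ne: "card B = 2" using B \<gamma>M unfolding matchings_iff by auto
    then obtain s t where st: "B = {s, t}" "s \<noteq> t" by (auto simp: card_2_iff)
    consider "B \<subseteq> tops m" | "B \<subseteq> bots n" | "B \<in> crossing (tops m) (bots n) \<gamma>"
      using crossing_decomposition(4)[OF \<gamma>M] B by auto
    then show ?thesis
    proof cases
      case 1
      have "B \<in> ?\<delta>"
      proof (cases "B = {x, y}")
        case False
        then have "B \<in> \<alpha>" using \<alpha>(2) B 1 by auto
        then show ?thesis using bprod_upper[OF \<alpha>B \<sigma>] 1 st by auto
      qed (use xy\<delta> in simp)
      then show ?thesis using bprod_upper[OF \<delta>B \<beta>B] 1 st by auto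
    next
      case 2
      show ?thesis
      proof (cases "B = {u, v}")
        case True
        have "{u, v} \<in> bprod m n ?\<delta> \<beta>"
          by (rule bprod_joined_lower[OF \<delta>B \<beta>B _ _ cd\<delta>])
            (use \<beta>(3)[of u] \<beta>(3)[of v] e2uv uv cd in auto)
        with True show ?thesis by simp
      next
        case False
        then have "B \<in> \<beta>" using \<beta>(2) B 2 by auto
        then show ?thesis using bprod_lower[OF \<delta>B \<beta>B] 2 st by auto
      qed
    next
      case 3
      then obtain z where z: "z \<in> B" "z \<in> X" unfolding crossing_def X_def T_def by auto
      define w where "w = mate \<gamma> z"
      have w: "w \<in> Y" "mate \<gamma> w = z"
        using bij_betwE[OF \<gamma>bij] z mate_mate[OF \<gamma>M] unfolding w_def by auto
      have Bzw: "B = {z, w}"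
        using st z mate_block[OF \<gamma>M B] unfolding w_def by auto
      have "{z, w} \<in> bprod m n ?\<delta> \<beta>"
      proof (rule bprod_transversal[OF \<delta>B \<beta>B])
        show "{z, flip (flip (mate \<sigma> (e z)))} \<in> ?\<delta>" using trans\<delta> z by simp
        show "{flip (mate \<sigma> (e z)), w} \<in> \<beta>"
          using \<beta>(3)[of w] w e2Y by (simp add: insert_commute)
        show "flip (mate \<sigma> (e z)) \<in> tops m" using \<sigma>e[OF z(2)] flip_bots by auto
      qed (use z w X_def Y_def in auto)
      then show ?thesis unfolding Bzw .
    qed
  qed
  have "\<gamma> = sandwich m n \<sigma> \<alpha> \<beta>"
    unfolding sandwich_def
    by (rule matchings_subset_eq[OF \<gamma>M]) (use block bprod_brauer[OF \<delta>B \<beta>B] brauer_eq in auto)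
  then show ?thesis using that[OF \<alpha>B \<beta>B] \<alpha>(4) \<beta>(4) unfolding q_def brank_eq
    by (simp add: crossing_commute)
qed

section \<open>Generation and rank\<close>

theorem theorem6p8:
  fixes m n r :: nat and \<sigma> :: "point set set" and \<Omega> :: "point set set set"
  assumes "[m = n] (mod 2)"
    and "\<sigma> \<in> brauer n m"
    and "r = brank n m \<sigma>"
    and "r < n" and "n \<le> m"
    and "\<Omega> = {\<alpha> \<in> brauer m n. brank m n \<alpha> > r}"
  shows "generates (brauer m n) (sandwich m n \<sigma>) \<Omega>
    \<and> (\<forall>A. generates (brauer m n) (sandwich m n \<sigma>) A \<longrightarrow> \<Omega> \<subseteq> A)
    \<and> semigroup_rank (brauer m n) (sandwich m n \<sigma>) = card \<Omega>
    \<and> card \<Omega> = (\<Sum>q \<in> {q. r < q \<and> q \<le> n \<and> [q = n] (mod 2)}.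
        (m choose q) * (n choose q) * double_fact (int m - int q - 1)
          * double_fact (int n - int q - 1) * fact q)"
proof -
  let ?f = "sandwich m n \<sigma>"
  note \<sigma> = assms(2) and \<Omega> = assms(6)
  have f_brauer: "?f \<alpha> \<beta> \<in> brauer m n" if "\<alpha> \<in> brauer m n" "\<beta> \<in> brauer m n" for \<alpha> \<beta>
    unfolding sandwich_def by (rule bprod_brauer[OF bprod_brauer[OF that(1) \<sigma>] that(2)])
  have f_rank: "brank m n (?f \<alpha> \<beta>) \<le> r" if "\<alpha> \<in> brauer m n" "\<beta> \<in> brauer m n" for \<alpha> \<beta>
    using brank_bprod_le_left[OF bprod_brauer[OF that(1) \<sigma>] that(2)]
      brank_bprod_le_right[OF that(1) \<sigma>] unfolding sandwich_def assms(3) by simp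
  \<comment> \<open>Downward induction on the rank: a factorization raises it by two until it exceeds \<open>r\<close>.\<close>
  have "\<gamma> \<in> subsemigroup_gen ?f \<Omega>" if "\<gamma> \<in> brauer m n" for \<gamma>
    using that
  proof (induction "Suc r - brank m n \<gamma>" arbitrary: \<gamma> rule: less_induct)
    case less
    show ?case
    proof (cases "brank m n \<gamma> \<le> r")
      case True
      then obtain \<alpha> \<beta> where "\<alpha> \<in> brauer m n" "\<beta> \<in> brauer m n"
        "brank m n \<alpha> = brank m n \<gamma> + 2" "brank m n \<beta> = brank m n \<gamma> + 2" "\<gamma> = ?f \<alpha> \<beta>"
        using sandwich_factorization[OF \<sigma>] assms(3-5) less.prems by metis
      with less.hyps[of \<alpha>] less.hyps[of \<beta>] True show ?thesis
        by (auto intro: subsemigroup_gen.mult)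
    next
      case False
      then show ?thesis using less.prems unfolding \<Omega> by (auto intro: subsemigroup_gen.base)
    qed
  qed
  moreover have "\<gamma> \<in> brauer m n" if "\<gamma> \<in> subsemigroup_gen ?f \<Omega>" for \<gamma>
    using that by induction (auto simp: \<Omega> f_brauer)
  ultimately have gen: "generates (brauer m n) ?f \<Omega>" unfolding generates_def \<Omega> by blast
  \<comment> \<open>Products have rank at most \<open>r\<close>, so the elements of \<open>\<Omega>\<close> are not products.\<close>
  have least: "\<Omega> \<subseteq> A" if A: "generates (brauer m n) ?f A" for A
  proof
    fix \<gamma> assume "\<gamma> \<in> \<Omega>"
    then have \<gamma>: "\<gamma> \<in> subsemigroup_gen ?f A" "brank m n \<gamma> > r"
      using A unfolding \<Omega> generates_def by auto
    from \<gamma>(1) show "\<gamma> \<in> A"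
    proof cases
      case (mult \<alpha> \<beta>)
      then have "\<alpha> \<in> brauer m n" "\<beta> \<in> brauer m n" using A unfolding generates_def by auto
      with f_rank \<gamma>(2) mult(1) show ?thesis by (metis leD)
    qed
  qed
  have fin: "finite \<Omega>" unfolding \<Omega> using finite_brauer by simp
  have rank: "semigroup_rank (brauer m n) ?f = card \<Omega>"
    unfolding semigroup_rank_def
  proof (rule Least_equality)
    show "\<exists>A. generates (brauer m n) ?f A \<and> finite A \<and> card A = card \<Omega>" using gen fin by blast
    show "card \<Omega> \<le> k" if "\<exists>A. generates (brauer m n) ?f A \<and> finite A \<and> card A = k" for k
      using that least card_mono by blast
  qed
  let ?Q = "{q. r < q \<and> q \<le> n \<and> [q = n] (mod 2)}"
  have \<Omega>_eq: "\<Omega> = (\<Union>q\<in>?Q. {\<alpha> \<in> brauer m n. brank m n \<alpha> = q})"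
  proof -
    have "brank m n \<alpha> \<le> n" "[brank m n \<alpha> = n] (mod 2)" if "\<alpha> \<in> brauer m n" for \<alpha>
    proof -
      have \<alpha>: "\<alpha> \<in> matchings (bots n \<union> tops m)" using that unfolding brauer_eq' .
      show le: "brank m n \<alpha> \<le> n" using even_card_noncrossing(1)[OF \<alpha>] unfolding brank_eq' by simp
      have "even (n - brank m n \<alpha>)"
        using even_card_noncrossing(2)[OF \<alpha>] unfolding brank_eq' by simp
      with le have "even n = even (brank m n \<alpha>)" by simp
      then show "[brank m n \<alpha> = n] (mod 2)" unfolding cong_def by (simp add: mod2_eq_if)
    qed
    then show ?thesis unfolding \<Omega> by auto
  qed
  have "card \<Omega> = (\<Sum>q\<in>?Q. card {\<alpha> \<in> brauer m n. brank m n \<alpha> = q})"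
    unfolding \<Omega>_eq by (rule card_UN_disjoint) (use finite_brauer[of m n] in auto)
  also have "\<dots> = (\<Sum>q\<in>?Q. (m choose q) * (n choose q) * double_fact (int m - int q - 1)
      * double_fact (int n - int q - 1) * fact q)"
  proof (rule sum.cong[OF refl])
    fix q assume q: "q \<in> ?Q"
    have "even m = even n" "even q = even n"
      using q assms(1) unfolding cong_def mem_Collect_eq by (metis even_iff_mod_2_eq_zero)+
    moreover have "q \<le> n" "q \<le> m" using q assms(5) by auto
    ultimately have "q \<le> m" "even (m - q)" "even (n - q)" by simp_all
    then show "card {\<alpha> \<in> brauer m n. brank m n \<alpha> = q} = (m choose q) * (n choose q)
        * double_fact (int m - int q - 1) * double_fact (int n - int q - 1) * fact q"
      using card_matchings_crossing[of "tops m" "bots n" q] q unfolding brauer_eq brank_eq by simp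
  qed
  finally show ?thesis using gen least rank by blast
qed

end
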